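(* Let $G$ be a connected labeled Hamiltonian or labeled semi-Hamiltonian graph with $V(G)=[n]$. Then $\operatorname{ara}(I_G)=n-1$. In particular, $I_G$ is a set-theoretic complete intersection.
   Context: All graphs are finite and simple. Let $\mathbb{K}$ be a field, $[n]=\{1,\ldots,n\}$ and $S=\mathbb{K}[x_1,\ldots,x_{n+1}]$. For $1\le i<j\le n$ put $g_{ij}=x_ix_{j+1}-x_jx_{i+1}$. For a graph $G$ with vertex set $[n]$, the Hankel edge ideal $I_G\subset S$ is the ideal generated by the $g_{ij}$ with $i<j$ and $\{i,j\}\in E(G)$. $L_n$ is the path with vertex set $[n]$ and edges $\{i,i+1\}$, $1\le i\le n-1$. $C_n$ is the cycle with vertex set $[n]$ and edges $\{1,n\}$ and $\{i,i+1\}$, $1\le i\le n-1$ (a cycle has at least $3$ vertices). A graph $G$ on $[n]$ is a labeled Hamiltonian graph if $C_n$ is a subgraph of $G$; it is a labeled semi-Hamiltonian graph if $L_n$ is a subgraph of $G$ and $\{1,n\}\notin E(G)$. For an ideal $I$ of $S$, the arithmetical rank $\operatorname{ara}(I)$ is the least integer $r$ such that $\operatorname{rad}(I)=\operatorname{rad}(f_1,\ldots,f_r)$ for some $f_1,\ldots,f_r\in S$. The ideal $I$ is a set-theoretic complete intersection if $\operatorname{height} I=\operatorname{ara}(I)$. *)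

theory Defs
  imports
    "HOL-Library.Poly_Mapping"
    "HOL-Library.Extended_Nat"
    "HOL-Algebra.Ideal"
begin

section \<open>Polynomial rings in a given set of variables\<close>

text \<open>
  A polynomial is a finitely supported map from monomials to coefficients, and a monomial is a
  finitely supported map from variables to exponents.  The type
  \<open>('v \<Rightarrow>\<^sub>0 nat) \<Rightarrow>\<^sub>0 'k\<close> has all elements of \<open>'v\<close> as variables, so the polynomial ring in
  the variables \<open>V\<close> is cut out as a carrier; ideals, primes and generated ideals are then those
  of \<^theory>\<open>HOL-Algebra.Ideal\<close>, relative to this carrier.
\<close>

definition poly_ring :: "'v set \<Rightarrow> (('v \<Rightarrow>\<^sub>0 nat) \<Rightarrow>\<^sub>0 'k::comm_ring_1) ring"
  where "poly_ring V =
    \<lparr>carrier = {p. \<forall>m \<in> Poly_Mapping.keys p. Poly_Mapping.keys m \<subseteq> V},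
     monoid.mult = (*), one = 1, zero = 0, add = (+)\<rparr>"

definition var :: "'v \<Rightarrow> ('v \<Rightarrow>\<^sub>0 nat) \<Rightarrow>\<^sub>0 'k::comm_ring_1"
  where "var i = Poly_Mapping.single (Poly_Mapping.single i 1) 1"

lemma cring_poly_ring:
  fixes V :: "'v set"
  shows "cring (poly_ring V :: (('v \<Rightarrow>\<^sub>0 nat) \<Rightarrow>\<^sub>0 'k::comm_ring_1) ring)" (is "cring ?R")
proof (rule cringI)
  show "abelian_group ?R"
  proof (rule abelian_groupI)
    fix x y :: "('v \<Rightarrow>\<^sub>0 nat) \<Rightarrow>\<^sub>0 'k"
    assume x: "x \<in> carrier ?R" and y: "y \<in> carrier ?R"
    show "x \<oplus>\<^bsub>?R\<^esub> y \<in> carrier ?R"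
      using x y keys_add[of x y] by (auto simp: poly_ring_def)
  next
    fix x :: "('v \<Rightarrow>\<^sub>0 nat) \<Rightarrow>\<^sub>0 'k"
    assume x: "x \<in> carrier ?R"
    have "- x \<in> carrier ?R" "- x \<oplus>\<^bsub>?R\<^esub> x = \<zero>\<^bsub>?R\<^esub>"
      using x by (auto simp: poly_ring_def)
    then show "\<exists>z\<in>carrier ?R. z \<oplus>\<^bsub>?R\<^esub> x = \<zero>\<^bsub>?R\<^esub>"
      by blast
  qed (auto simp: poly_ring_def algebra_simps)
  show "comm_monoid ?R"
  proof (rule comm_monoidI)
    fix x y :: "('v \<Rightarrow>\<^sub>0 nat) \<Rightarrow>\<^sub>0 'k"
    assume x: "x \<in> carrier ?R" and y: "y \<in> carrier ?R"
    have "Poly_Mapping.keys m \<subseteq> V" if m: "m \<in> Poly_Mapping.keys (x * y)" for m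
    proof -
      obtain a b where "m = a + b" "a \<in> Poly_Mapping.keys x" "b \<in> Poly_Mapping.keys y"
        using m keys_mult[of x y] by auto
      then show ?thesis
        using x y keys_add[of a b] by (fastforce simp: poly_ring_def)
    qed
    then show "x \<otimes>\<^bsub>?R\<^esub> y \<in> carrier ?R"
      by (simp add: poly_ring_def)
  qed (auto simp: poly_ring_def algebra_simps)
qed (auto simp: poly_ring_def algebra_simps)

lemma var_in_carrier: "i \<in> V \<Longrightarrow> var i \<in> carrier (poly_ring V)"
  by (auto simp: poly_ring_def var_def)


section \<open>Radical, arithmetical rank and height\<close>

definition radical :: "('a, 'b) ring_scheme \<Rightarrow> 'a set \<Rightarrow> 'a set"
  where "radical R I = {a \<in> carrier R. \<exists>k::nat. k > 0 \<and> a [^]\<^bsub>R\<^esub> k \<in> I}"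

text \<open>
  In a Noetherian ring the set of admissible \<open>r\<close> is nonempty, so \<open>LEAST\<close> is meaningful there.
\<close>

definition ara :: "('a, 'b) ring_scheme \<Rightarrow> 'a set \<Rightarrow> nat"
  where "ara R I = (LEAST r. \<exists>f :: nat \<Rightarrow> 'a. f ` {1..r} \<subseteq> carrier R \<and>
    radical R I = radical R (Idl\<^bsub>R\<^esub> (f ` {1..r})))"

definition prime_chain :: "('a, 'b) ring_scheme \<Rightarrow> (nat \<Rightarrow> 'a set) \<Rightarrow> nat \<Rightarrow> bool"
  where "prime_chain R c h \<longleftrightarrow>
    (\<forall>i\<le>h. primeideal (c i) R) \<and> (\<forall>i<h. c i \<subset> c (Suc i))"

definition prime_height :: "('a, 'b) ring_scheme \<Rightarrow> 'a set \<Rightarrow> enat"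
  where "prime_height R P = Sup {enat h | h. \<exists>c. prime_chain R c h \<and> c h = P}"

text \<open>The height of the unit ideal is \<open>\<infinity>\<close> by the convention \<open>Inf {} = \<infinity>\<close>.\<close>

definition ideal_height :: "('a, 'b) ring_scheme \<Rightarrow> 'a set \<Rightarrow> enat"
  where "ideal_height R I = Inf {prime_height R P | P. primeideal P R \<and> I \<subseteq> P}"

definition set_theoretic_complete_intersection :: "('a, 'b) ring_scheme \<Rightarrow> 'a set \<Rightarrow> bool"
  where "set_theoretic_complete_intersection R I \<longleftrightarrow> ideal_height R I = enat (ara R I)"


section \<open>Graphs\<close>

text \<open>Graphs are given by a vertex set and a set of unordered edges.\<close>

definition simple_graph :: "'v set \<Rightarrow> 'v set set \<Rightarrow> bool"
  where "simple_graph V E \<longleftrightarrow> finite V \<and> (\<forall>e\<in>E. e \<subseteq> V \<and> card e = 2)"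

definition connected_graph :: "'v set \<Rightarrow> 'v set set \<Rightarrow> bool"
  where "connected_graph V E \<longleftrightarrow>
    V \<noteq> {} \<and> (\<forall>u\<in>V. \<forall>v\<in>V. (u, v) \<in> {(a, b). {a, b} \<in> E}\<^sup>*)"

definition path_edges :: "nat \<Rightarrow> nat set set"
  where "path_edges n = {{i, i + 1} | i. 1 \<le> i \<and> i < n}"

definition cycle_edges :: "nat \<Rightarrow> nat set set"
  where "cycle_edges n = insert {1, n} (path_edges n)"

definition labeled_hamiltonian :: "nat \<Rightarrow> nat set set \<Rightarrow> bool"
  where "labeled_hamiltonian n E \<longleftrightarrow> 3 \<le> n \<and> cycle_edges n \<subseteq> E"

definition labeled_semi_hamiltonian :: "nat \<Rightarrow> nat set set \<Rightarrow> bool"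
  where "labeled_semi_hamiltonian n E \<longleftrightarrow> path_edges n \<subseteq> E \<and> {1, n} \<notin> E"


section \<open>Hankel edge ideals\<close>

abbreviation hankel_ring :: "nat \<Rightarrow> ((nat \<Rightarrow>\<^sub>0 nat) \<Rightarrow>\<^sub>0 'k::comm_ring_1) ring"
  where "hankel_ring n \<equiv> poly_ring {1..n + 1}"

definition hankel_binomial :: "nat \<Rightarrow> nat \<Rightarrow> (nat \<Rightarrow>\<^sub>0 nat) \<Rightarrow>\<^sub>0 'k::comm_ring_1"
  where "hankel_binomial i j = var i * var (j + 1) - var j * var (i + 1)"

definition hankel_edge_ideal :: "nat \<Rightarrow> nat set set \<Rightarrow> ((nat \<Rightarrow>\<^sub>0 nat) \<Rightarrow>\<^sub>0 'k::comm_ring_1) set"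
  where "hankel_edge_ideal n E =
    Idl\<^bsub>hankel_ring n\<^esub> {hankel_binomial i j | i j. i < j \<and> {i, j} \<in> E}"

end

(* A prime that contains the binomials g_{i,i+1} of the path contains either x_2, ..., x_n or the ideal
   of the rational normal curve.  Both components have height n - 1.  The height of a prime is bounded
   below by chains of kernels of substitutions, and above because each step down in a chain of primes
   adds one algebraically independent element modulo the prime.

   Testing on primes, I_G has the same radical as the path binomials when {1,n} is not an edge, and as
   the n - 1 equations of Robbiano and Valla for the rational normal curve when {1,n} is an edge.
   Conversely, r polynomials with the radical of I_G, together with x_1 and x_{n+1}, cut out the origin
   of (n+1)-space; comparing the growth of Hilbert functions at the origin gives n + 1 <= r + 2. *)
theory Submission
  imports Defs "HOL-Algebra.Ring_Divisibility"
begin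

section \<open>Substitution homomorphisms\<close>

text \<open>The path binomials cut out a plane, x_2 = ... = x_n = 0, together with the cone over the
  rational normal curve. On the plane, the binomial of an edge {i,j} with i < j vanishes unless i =
  1 and j = n, when it equals x_1 x_{n+1}. Hence without the edge {1,n} all further edges are
  redundant up to radical. With it, the plane shrinks to its two coordinate lines; these lie on the
  cone, so the cone alone remains.

  Away from x_1 = 0 a point of the cone is determined by x_1 and t = x_2/x_1, through x_{j+1} = x_1
  t^j. Such quotients do not exist in the ring. Identities are therefore multiplied by a power of
  x_1, verified modulo a prime, and divided again by primality, which is why tests run over primes
  that do or do not contain x_1.

  Dimension enters only by counting: a homogeneous linear system with more unknowns than equations
  has a nonzero solution. This yields both the bound on independent elements, hence on chains of
  primes, and the bound on the number of generators at the origin.\<close>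

definition subst_monom :: "('v \<Rightarrow> ('w \<Rightarrow>\<^sub>0 nat) \<Rightarrow>\<^sub>0 'k::comm_ring_1) \<Rightarrow> ('v \<Rightarrow>\<^sub>0 nat) \<Rightarrow> ('w \<Rightarrow>\<^sub>0 nat) \<Rightarrow>\<^sub>0 'k"
  where "subst_monom \<sigma> m = (\<Prod>i\<in>Poly_Mapping.keys m. \<sigma> i ^ Poly_Mapping.lookup m i)"

definition subst :: "('v \<Rightarrow> ('w \<Rightarrow>\<^sub>0 nat) \<Rightarrow>\<^sub>0 'k::comm_ring_1) \<Rightarrow> (('v \<Rightarrow>\<^sub>0 nat) \<Rightarrow>\<^sub>0 'k) \<Rightarrow> ('w \<Rightarrow>\<^sub>0 nat) \<Rightarrow>\<^sub>0 'k"
  where "subst \<sigma> p = (\<Sum>m\<in>Poly_Mapping.keys p. Poly_Mapping.single 0 (Poly_Mapping.lookup p m) * subst_monom \<sigma> m)"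

lemma subst_monom_superset:
  assumes "finite A" "Poly_Mapping.keys m \<subseteq> A"
  shows "subst_monom \<sigma> m = (\<Prod>i\<in>A. \<sigma> i ^ Poly_Mapping.lookup m i)"
  unfolding subst_monom_def using assms
  by (intro prod.mono_neutral_left) (auto simp: in_keys_iff)

lemma subst_monom_zero [simp]: "subst_monom \<sigma> 0 = 1"
  by (simp add: subst_monom_def)

lemma subst_monom_add: "subst_monom \<sigma> (m + m') = subst_monom \<sigma> m * subst_monom \<sigma> m'"
proof -
  let ?A = "Poly_Mapping.keys m \<union> Poly_Mapping.keys m'"
  have "subst_monom \<sigma> (m + m') = (\<Prod>i\<in>?A. \<sigma> i ^ Poly_Mapping.lookup (m + m') i)"
    by (rule subst_monom_superset) (auto dest: subsetD[OF keys_add])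
  also have "\<dots> = (\<Prod>i\<in>?A. \<sigma> i ^ Poly_Mapping.lookup m i) * (\<Prod>i\<in>?A. \<sigma> i ^ Poly_Mapping.lookup m' i)"
    by (simp only: lookup_add power_add prod.distrib)
  also have "\<dots> = subst_monom \<sigma> m * subst_monom \<sigma> m'"
    by (intro arg_cong2[of _ _ _ _ "(*)"] subst_monom_superset[symmetric]) auto
  finally show ?thesis .
qed

lemma subst_superset:
  assumes "finite A" "Poly_Mapping.keys p \<subseteq> A"
  shows "subst \<sigma> p = (\<Sum>m\<in>A. Poly_Mapping.single 0 (Poly_Mapping.lookup p m) * subst_monom \<sigma> m)"
  unfolding subst_def using assms
  by (intro sum.mono_neutral_left) (auto simp: in_keys_iff)

lemma subst_zero [simp]: "subst \<sigma> 0 = 0"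
  by (simp add: subst_def)

lemma subst_add: "subst \<sigma> (p + q) = subst \<sigma> p + subst \<sigma> q"
proof -
  let ?A = "Poly_Mapping.keys p \<union> Poly_Mapping.keys q"
  have "subst \<sigma> (p + q) = (\<Sum>m\<in>?A. Poly_Mapping.single 0 (Poly_Mapping.lookup (p + q) m) * subst_monom \<sigma> m)"
    by (rule subst_superset) (auto dest: subsetD[OF keys_add])
  also have "\<dots> = (\<Sum>m\<in>?A. Poly_Mapping.single 0 (Poly_Mapping.lookup p m) * subst_monom \<sigma> m)
      + (\<Sum>m\<in>?A. Poly_Mapping.single 0 (Poly_Mapping.lookup q m) * subst_monom \<sigma> m)"
    by (simp only: lookup_add single_add distrib_right sum.distrib)
  also have "\<dots> = subst \<sigma> p + subst \<sigma> q"
    by (intro arg_cong2[of _ _ _ _ "(+)"] subst_superset[symmetric]) auto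
  finally show ?thesis .
qed

lemma subst_single: "subst \<sigma> (Poly_Mapping.single m c) = Poly_Mapping.single 0 c * subst_monom \<sigma> m"
  by (subst subst_superset[of "{m}"]) auto

lemma poly_mapping_sum_single:
  "p = (\<Sum>m\<in>Poly_Mapping.keys p. Poly_Mapping.single m (Poly_Mapping.lookup p m))"
proof (rule poly_mapping_eqI)
  fix m
  have "(\<Sum>k\<in>Poly_Mapping.keys p. Poly_Mapping.lookup p k when k = m) =
      (\<Sum>k\<in>Poly_Mapping.keys p. if k = m then Poly_Mapping.lookup p k else 0)"
    by (intro sum.cong) auto
  then show "Poly_Mapping.lookup p m = Poly_Mapping.lookup (\<Sum>m\<in>Poly_Mapping.keys p.
      Poly_Mapping.single m (Poly_Mapping.lookup p m)) m"
    by (simp add: lookup_sum lookup_single in_keys_iff)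
qed

lemma poly_mapping_single_induct [case_names single add]:
  fixes p :: "'a \<Rightarrow>\<^sub>0 'b::comm_monoid_add"
  assumes single: "\<And>m c. P (Poly_Mapping.single m c)"
    and add: "\<And>p q. P p \<Longrightarrow> P q \<Longrightarrow> P (p + q)"
  shows "P p"
proof -
  have "P (\<Sum>m\<in>A. Poly_Mapping.single m (Poly_Mapping.lookup p m))" if "finite A" for A
    using that
  proof (induction A rule: finite_induct)
    case empty
    then show ?case
      using single[of undefined 0] by simp
  qed (auto intro: single add)
  then show ?thesis
    using poly_mapping_sum_single[of p] by (metis finite_keys)
qed

lemma subst_mult: "subst \<sigma> (p * q) = subst \<sigma> p * subst \<sigma> q"
proof (induction p rule: poly_mapping_single_induct)
  case (single m c)
  show ?case
  proof (induction q rule: poly_mapping_single_induct)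
    case (single m' c')
    have const_mult: "Poly_Mapping.single 0 (c * c') = Poly_Mapping.single 0 c * (Poly_Mapping.single 0 c' :: (_ \<Rightarrow>\<^sub>0 nat) \<Rightarrow>\<^sub>0 _)"
      by (simp add: mult_single)
    show ?case
      unfolding mult_single subst_single subst_monom_add by (subst const_mult) (simp only: ac_simps)
  qed (simp add: algebra_simps subst_add)
qed (simp add: algebra_simps subst_add)

lemma subst_const [simp]: "subst \<sigma> (Poly_Mapping.single 0 c) = Poly_Mapping.single 0 c"
  by (simp add: subst_single)

lemma subst_one [simp]: "subst \<sigma> 1 = 1"
  using subst_const[of \<sigma> 1] by simp

lemma subst_var [simp]: "subst \<sigma> (var i) = \<sigma> i"
  by (simp add: var_def subst_single subst_monom_def)

lemma subst_uminus: "subst \<sigma> (- p) = - subst \<sigma> p"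
  using subst_add[of \<sigma> p "- p"] by (simp add: eq_neg_iff_add_eq_0 add.commute)

lemma subst_diff: "subst \<sigma> (p - q) = subst \<sigma> p - subst \<sigma> q"
  using subst_add[of \<sigma> p "- q"] by (simp add: subst_uminus)

lemma subst_power: "subst \<sigma> (p ^ k) = subst \<sigma> p ^ k"
  by (induction k) (auto simp: subst_mult)

lemma subst_sum: "subst \<sigma> (sum f A) = (\<Sum>a\<in>A. subst \<sigma> (f a))"
  by (induction A rule: infinite_finite_induct) (auto simp: subst_add)

lemmas subst_simps = subst_add subst_mult subst_uminus subst_diff subst_power subst_sum

lemma single_eq_const_times_monom:
  "Poly_Mapping.single m c = Poly_Mapping.single 0 c * subst_monom var m"
proof -
  have "subst_monom (var :: _ \<Rightarrow> (_ \<Rightarrow>\<^sub>0 nat) \<Rightarrow>\<^sub>0 'b) m = Poly_Mapping.single m 1"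
  proof (induction m rule: poly_mapping_single_induct)
    case (single i k)
    have "(var i :: (_ \<Rightarrow>\<^sub>0 nat) \<Rightarrow>\<^sub>0 'b) ^ k = Poly_Mapping.single (Poly_Mapping.single i k) 1"
    proof (induction k)
      case (Suc k)
      then show ?case
        using single_add[of i 1 k] by (simp add: var_def mult_single)
    qed simp
    then show ?case
      by (subst subst_monom_superset[of "{i}"]) auto
  qed (simp add: subst_monom_add mult_single)
  then show ?thesis
    by (simp add: mult_single)
qed

text \<open>A monomial is a product of variables, so identities between substitutions and
  congruences modulo an ideal need only be checked on constants and variables.\<close>

lemma mpoly_induct [case_names const var add mult]:
  fixes p :: "('v \<Rightarrow>\<^sub>0 nat) \<Rightarrow>\<^sub>0 'k::comm_ring_1"
  assumes const: "\<And>c. P (Poly_Mapping.single 0 c)"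
    and var: "\<And>i. P (var i)"
    and add: "\<And>p q. P p \<Longrightarrow> P q \<Longrightarrow> P (p + q)"
    and mult: "\<And>p q. P p \<Longrightarrow> P q \<Longrightarrow> P (p * q)"
  shows "P p"
proof (induction p rule: poly_mapping_single_induct)
  case (single m c)
  have one: "P 1"
    using const[of 1] by simp
  have "P (var i ^ k)" for i k
    by (induction k) (auto intro: one var mult)
  then have "P (\<Prod>i\<in>A. var i ^ Poly_Mapping.lookup m i)" for A
    by (induction A rule: infinite_finite_induct) (auto intro: one mult)
  then show ?case
    unfolding single_eq_const_times_monom[of m c] subst_monom_def by (intro mult const)
qed (rule add)

lemma subst_subst: "subst \<tau> (subst \<sigma> p) = subst (\<lambda>i. subst \<tau> (\<sigma> i)) p"
  by (induction p rule: mpoly_induct) (simp_all add: subst_simps)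

lemma subst_var_id [simp]: "subst var p = p"
  by (induction p rule: mpoly_induct) (simp_all add: subst_simps)

section \<open>Closure properties of polynomial rings\<close>

lemma poly_ring_simps [simp]:
  "monoid.mult (poly_ring V) = (*)" "monoid.one (poly_ring V) = 1"
  "ring.zero (poly_ring V) = 0" "ring.add (poly_ring V) = (+)"
  by (simp_all add: poly_ring_def)

lemma poly_ring_carrier_iff:
  "p \<in> carrier (poly_ring V) \<longleftrightarrow> (\<forall>m\<in>Poly_Mapping.keys p. Poly_Mapping.keys m \<subseteq> V)"
  by (simp add: poly_ring_def)

lemma poly_ring_add: "p \<in> carrier (poly_ring V) \<Longrightarrow> q \<in> carrier (poly_ring V) \<Longrightarrow> p + q \<in> carrier (poly_ring V)"
  using ring.ring_simprules(1)[OF cring.axioms(1)[OF cring_poly_ring[of V]], of p q] by simp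

lemma poly_ring_mult: "p \<in> carrier (poly_ring V) \<Longrightarrow> q \<in> carrier (poly_ring V) \<Longrightarrow> p * q \<in> carrier (poly_ring V)"
  using ring.ring_simprules(5)[OF cring.axioms(1)[OF cring_poly_ring[of V]], of p q] by simp

lemma poly_ring_uminus: "p \<in> carrier (poly_ring V) \<Longrightarrow> - p \<in> carrier (poly_ring V)"
  by (simp add: poly_ring_carrier_iff)

lemma poly_ring_diff: "p \<in> carrier (poly_ring V) \<Longrightarrow> q \<in> carrier (poly_ring V) \<Longrightarrow> p - q \<in> carrier (poly_ring V)"
  using poly_ring_add[of p V "- q"] poly_ring_uminus[of q V] by simp

lemma poly_ring_const: "Poly_Mapping.single 0 c \<in> carrier (poly_ring V)"
  by (auto simp: poly_ring_carrier_iff)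

lemma poly_ring_zero: "0 \<in> carrier (poly_ring V)" and poly_ring_one: "1 \<in> carrier (poly_ring V)"
  by (auto simp: poly_ring_carrier_iff)

lemma poly_ring_power: "p \<in> carrier (poly_ring V) \<Longrightarrow> p ^ k \<in> carrier (poly_ring V)"
  by (induction k) (auto simp: poly_ring_mult poly_ring_one)

lemma poly_ring_sum: "(\<And>a. a \<in> A \<Longrightarrow> f a \<in> carrier (poly_ring V)) \<Longrightarrow> sum f A \<in> carrier (poly_ring V)"
  by (induction A rule: infinite_finite_induct) (auto simp: poly_ring_add poly_ring_zero)

lemma poly_ring_prod: "(\<And>a. a \<in> A \<Longrightarrow> f a \<in> carrier (poly_ring V)) \<Longrightarrow> prod f A \<in> carrier (poly_ring V)"
  by (induction A rule: infinite_finite_induct) (auto simp: poly_ring_mult poly_ring_one)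

lemmas poly_ring_closed = poly_ring_add poly_ring_mult poly_ring_uminus poly_ring_diff poly_ring_const
  poly_ring_zero poly_ring_one poly_ring_power poly_ring_sum poly_ring_prod var_in_carrier

lemma poly_ring_nat_pow: "p [^]\<^bsub>poly_ring V\<^esub> (k::nat) = p ^ k"
  by (induction k) (simp_all add: mult.commute)

lemma poly_ring_a_inv: "p \<in> carrier (poly_ring V) \<Longrightarrow> \<ominus>\<^bsub>poly_ring V\<^esub> p = - p"
  using abelian_group.minus_equality[of "poly_ring V" "- p" p] poly_ring_uminus[of p V]
    ring.is_abelian_group[OF cring.axioms(1)[OF cring_poly_ring[of V]]] by simp

lemma subst_closed:
  assumes "p \<in> carrier (poly_ring V)" "\<And>i. i \<in> V \<Longrightarrow> \<sigma> i \<in> carrier (poly_ring W)"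
  shows "subst \<sigma> p \<in> carrier (poly_ring W)"
  unfolding subst_def subst_monom_def using assms
  by (intro poly_ring_sum poly_ring_mult poly_ring_const poly_ring_prod poly_ring_power)
    (auto simp: poly_ring_carrier_iff[of p])

lemma subst_cong:
  assumes "p \<in> carrier (poly_ring V)" "\<And>i. i \<in> V \<Longrightarrow> \<sigma> i = \<tau> i"
  shows "subst \<sigma> p = subst \<tau> p"
proof -
  have "\<sigma> i = \<tau> i" if "m \<in> Poly_Mapping.keys p" "i \<in> Poly_Mapping.keys m" for m i
    using that assms by (meson poly_ring_carrier_iff subsetD)
  then show ?thesis
    by (simp add: subst_def subst_monom_def)
qed

section \<open>Prime ideals without carriers\<close>

text \<open>Formulated for a whole type instead of a carrier, so that computations modulo a prime
  produce no membership side conditions; \<open>lift_ideal\<close> makes the connection to primes of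
  \<open>poly_ring V\<close>.\<close>

locale prime_subset =
  fixes Q :: "'a::comm_ring_1 set"
  assumes zero_mem: "0 \<in> Q"
    and add_mem: "a \<in> Q \<Longrightarrow> b \<in> Q \<Longrightarrow> a + b \<in> Q"
    and mult_mem: "a \<in> Q \<Longrightarrow> r * a \<in> Q"
    and one_not_mem: "1 \<notin> Q"
    and prime_mem: "a * b \<in> Q \<Longrightarrow> a \<in> Q \<or> b \<in> Q"
begin

lemma mult_mem_right: "a \<in> Q \<Longrightarrow> a * r \<in> Q"
  using mult_mem[of a r] by (simp add: mult.commute)

lemma uminus_mem: "a \<in> Q \<Longrightarrow> - a \<in> Q"
  using mult_mem[of a "- 1"] by simp

lemma diff_mem: "a \<in> Q \<Longrightarrow> b \<in> Q \<Longrightarrow> a - b \<in> Q"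
  using add_mem[of a "- b"] uminus_mem[of b] by simp

lemma sum_mem: "(\<And>x. x \<in> A \<Longrightarrow> f x \<in> Q) \<Longrightarrow> sum f A \<in> Q"
  by (induction A rule: infinite_finite_induct) (auto simp: zero_mem add_mem)

lemma power_memD: "a ^ k \<in> Q \<Longrightarrow> a \<in> Q"
  by (induction k) (auto simp: one_not_mem dest: prime_mem)

lemma power_mem: "a \<in> Q \<Longrightarrow> k > 0 \<Longrightarrow> a ^ k \<in> Q"
  by (cases k) (auto simp: mult_mem_right)

lemma mem_cong: "a - b \<in> Q \<Longrightarrow> a \<in> Q \<longleftrightarrow> b \<in> Q"
  using add_mem[of "a - b" b] diff_mem[of a "a - b"] by auto

lemma diff_trans: "a - b \<in> Q \<Longrightarrow> b - c \<in> Q \<Longrightarrow> a - c \<in> Q"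
  using add_mem[of "a - b" "b - c"] by simp

lemma diff_add: "a - b \<in> Q \<Longrightarrow> c - d \<in> Q \<Longrightarrow> (a + c) - (b + d) \<in> Q"
  using add_mem[of "a - b" "c - d"] by (simp add: algebra_simps)

lemma diff_mult: "a - b \<in> Q \<Longrightarrow> c - d \<in> Q \<Longrightarrow> a * c - b * d \<in> Q"
  using add_mem[OF mult_mem[of "a - b" c] mult_mem[of "c - d" b]] by (simp add: algebra_simps)

lemma diff_power: "a - b \<in> Q \<Longrightarrow> a ^ k - b ^ k \<in> Q"
  by (induction k) (auto simp: zero_mem diff_mult)

lemma diff_sum: "(\<And>x. x \<in> A \<Longrightarrow> f x - g x \<in> Q) \<Longrightarrow> sum f A - sum g A \<in> Q"
  using sum_mem[of A "\<lambda>x. f x - g x"] by (simp add: sum_subtractf)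

end

lemma prime_subset_diff_subst:
  assumes "prime_subset Q" "\<And>i. \<sigma> i - \<tau> i \<in> Q"
  shows "subst \<sigma> p - subst \<tau> p \<in> Q"
proof -
  interpret prime_subset Q by fact
  show ?thesis
    by (induction p rule: mpoly_induct)
      (auto simp: subst_simps zero_mem assms(2) intro: diff_add diff_mult)
qed

section \<open>Passage between primes of \<open>poly_ring V\<close> and primes of the whole
  type\<close>

definition restrict_vars :: "'v set \<Rightarrow> (('v \<Rightarrow>\<^sub>0 nat) \<Rightarrow>\<^sub>0 'k::comm_ring_1) \<Rightarrow> ('v \<Rightarrow>\<^sub>0 nat) \<Rightarrow>\<^sub>0 'k"
  where "restrict_vars V = subst (\<lambda>i. if i \<in> V then var i else 0)"

lemma restrict_vars_closed: "restrict_vars V p \<in> carrier (poly_ring V)"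
  unfolding restrict_vars_def
  by (rule subst_closed[of _ UNIV]) (auto simp: poly_ring_closed, auto simp: poly_ring_carrier_iff)

lemma restrict_vars_id:
  assumes "p \<in> carrier (poly_ring V)"
  shows "restrict_vars V p = p"
  using subst_cong[OF assms, of "\<lambda>i. if i \<in> V then var i else 0" var]
  by (simp add: restrict_vars_def)

text \<open>The preimage of \<open>Q\<close> under the retraction that sends the variables outside \<open>V\<close> to \<open>0\<close>;
  passing to it removes all carrier conditions.\<close>

definition lift_ideal :: "'v set \<Rightarrow> (('v \<Rightarrow>\<^sub>0 nat) \<Rightarrow>\<^sub>0 'k::comm_ring_1) set \<Rightarrow> (('v \<Rightarrow>\<^sub>0 nat) \<Rightarrow>\<^sub>0 'k) set"
  where "lift_ideal V Q = {p. restrict_vars V p \<in> Q}"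

lemma mem_lift_ideal_iff: "p \<in> carrier (poly_ring V) \<Longrightarrow> p \<in> lift_ideal V Q \<longleftrightarrow> p \<in> Q"
  by (simp add: lift_ideal_def restrict_vars_id)

lemma lift_ideal_mono: "P \<subseteq> Q \<Longrightarrow> lift_ideal V P \<subseteq> lift_ideal V Q"
  by (auto simp: lift_ideal_def)

lemma ideal_poly_ringD:
  assumes "ideal I (poly_ring V)"
  shows "I \<subseteq> carrier (poly_ring V)" "0 \<in> I" "a \<in> I \<Longrightarrow> b \<in> I \<Longrightarrow> a + b \<in> I"
    "a \<in> I \<Longrightarrow> r \<in> carrier (poly_ring V) \<Longrightarrow> r * a \<in> I"
proof -
  interpret ideal I "poly_ring V" by fact
  show "I \<subseteq> carrier (poly_ring V)" "0 \<in> I"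
    using additive_subgroup.zero_closed[OF additive_subgroup_axioms] a_subset by auto
  show "a \<in> I \<Longrightarrow> b \<in> I \<Longrightarrow> a + b \<in> I"
    using additive_subgroup.a_closed[OF additive_subgroup_axioms, of a b] by simp
  show "a \<in> I \<Longrightarrow> r \<in> carrier (poly_ring V) \<Longrightarrow> r * a \<in> I"
    using I_l_closed[of a r] by simp
qed

lemma ideal_poly_ring_sum:
  assumes "ideal I (poly_ring V)" "\<And>x. x \<in> A \<Longrightarrow> f x \<in> I"
  shows "sum f A \<in> I"
  using assms(2)
  by (induction A rule: infinite_finite_induct) (auto simp: ideal_poly_ringD[OF assms(1)])

lemma ideal_poly_ringI:
  assumes "I \<subseteq> carrier (poly_ring V)" "0 \<in> I" "\<And>a b. a \<in> I \<Longrightarrow> b \<in> I \<Longrightarrow> a + b \<in> I"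
    "\<And>a r. a \<in> I \<Longrightarrow> r \<in> carrier (poly_ring V) \<Longrightarrow> r * a \<in> I"
  shows "ideal I (poly_ring V)"
proof -
  interpret cring "poly_ring V" by (rule cring_poly_ring)
  show ?thesis
  proof (rule idealI)
    show "subgroup I (add_monoid (poly_ring V))"
    proof (rule group.subgroupI)
      show "inv\<^bsub>add_monoid (poly_ring V)\<^esub> a \<in> I" if "a \<in> I" for a
      proof -
        have "inv\<^bsub>add_monoid (poly_ring V)\<^esub> a = - 1 * a"
          using poly_ring_a_inv[of a V] that assms(1) by (auto simp: a_inv_def)
        also have "\<dots> \<in> I"
          by (intro assms(4) that poly_ring_closed)
        finally show ?thesis .
      qed
    qed (use assms a_group in auto)
  qed (use assms ring_axioms in \<open>auto simp: mult.commute\<close>)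
qed

lemma prime_subset_lift_ideal:
  assumes "primeideal Q (poly_ring V)"
  shows "prime_subset (lift_ideal V Q)"
proof -
  interpret primeideal Q "poly_ring V" by fact
  note [simp] = ideal_poly_ringD[OF ideal_axioms] restrict_vars_closed
  show ?thesis
  proof
    show "1 \<notin> lift_ideal V Q"
      using one_imp_carrier I_notcarr by (auto simp: mem_lift_ideal_iff poly_ring_one)
    show "a \<in> lift_ideal V Q \<or> b \<in> lift_ideal V Q" if "a * b \<in> lift_ideal V Q" for a b
      using that I_prime[of "restrict_vars V a" "restrict_vars V b"]
      by (simp add: lift_ideal_def) (simp add: restrict_vars_def subst_mult)
    show "r * a \<in> lift_ideal V Q" if "a \<in> lift_ideal V Q" for a r
    proof -
      have "restrict_vars V (r * a) = restrict_vars V r * restrict_vars V a"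
        by (simp add: restrict_vars_def subst_mult)
      then show ?thesis
        using that by (simp add: lift_ideal_def)
    qed
    show "a + b \<in> lift_ideal V Q" if "a \<in> lift_ideal V Q" "b \<in> lift_ideal V Q" for a b
    proof -
      have "restrict_vars V (a + b) = restrict_vars V a + restrict_vars V b"
        by (simp add: restrict_vars_def subst_add)
      then show ?thesis
        using that by (simp add: lift_ideal_def)
    qed
  qed (simp add: lift_ideal_def restrict_vars_def)
qed

lemma primeideal_Int_carrier:
  fixes P :: "(('v \<Rightarrow>\<^sub>0 nat) \<Rightarrow>\<^sub>0 'k::comm_ring_1) set"
  assumes "prime_subset P"
  shows "primeideal (P \<inter> carrier (poly_ring V)) (poly_ring V)"
proof -
  interpret P: prime_subset P by fact
  show ?thesis
  proof (rule primeidealI)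
    show "ideal (P \<inter> carrier (poly_ring V)) (poly_ring V)"
      by (rule ideal_poly_ringI) (auto simp: P.zero_mem P.add_mem P.mult_mem poly_ring_closed)
    show "carrier (poly_ring V) \<noteq> P \<inter> carrier (poly_ring V)"
      using P.one_not_mem poly_ring_one by blast
  qed (use P.prime_mem in \<open>auto simp: cring_poly_ring\<close>)
qed

text \<open>The linear order on the variables of the target orders its monomials, which makes the
  target an integral domain; kernels of maps into a domain are prime.\<close>

lemma prime_subset_kernel:
  fixes \<sigma> :: "'v \<Rightarrow> ('w::linorder \<Rightarrow>\<^sub>0 nat) \<Rightarrow>\<^sub>0 'k::idom"
  shows "prime_subset {p. subst \<sigma> p = 0}"
  by standard (auto simp: subst_simps)

section \<open>Counting monomials\<close>

text \<open>Gaussian elimination, one equation at a time.\<close>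

lemma homogeneous_system_nontrivial:
  fixes a :: "'b \<Rightarrow> 't \<Rightarrow> 'k::field"
  assumes "finite T" "finite B" "card T < card B"
  shows "\<exists>c. (\<exists>b\<in>B. c b \<noteq> 0) \<and> (\<forall>t\<in>T. (\<Sum>b\<in>B. c b * a b t) = 0)"
  using assms
proof (induction T arbitrary: B a rule: finite_induct)
  case empty
  then have "B \<noteq> {}"
    by auto
  then show ?case
    by (intro exI[of _ "\<lambda>_. 1"]) auto
next
  case (insert t T)
  show ?case
  proof (cases "\<exists>b\<in>B. a b t \<noteq> 0")
    case False
    then show ?thesis
      using insert.IH[of B a] insert.prems insert.hyps by auto
  next
    case True
    then obtain b0 where b0: "b0 \<in> B" "a b0 t \<noteq> 0"
      by blast
    \<comment> \<open>Equation \<open>t\<close> is solved for the unknown at \<open>b0\<close>.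
      Subtracting multiples of it removes \<open>b0\<close> from the other equations, which leaves
      one equation and one unknown less.\<close>
    let ?B = "B - {b0}"
    have "card T < card ?B"
      using insert b0 by simp
    then obtain c where c: "\<exists>b\<in>?B. c b \<noteq> 0"
      and c0: "\<And>s. s \<in> T \<Longrightarrow> (\<Sum>b\<in>?B. c b * (a b s - a b t / a b0 t * a b0 s)) = 0"
      using insert.IH[of ?B "\<lambda>b s. a b s - a b t / a b0 t * a b0 s"] insert.prems by auto
    let ?e = "- (\<Sum>b\<in>?B. c b * a b t) / a b0 t"
    let ?c = "c(b0 := ?e)"
    have split: "(\<Sum>b\<in>B. ?c b * a b s) = ?e * a b0 s + (\<Sum>b\<in>?B. c b * a b s)" for s
      using insert.prems b0 by (subst sum.remove[of B b0]) auto
    have "(\<Sum>b\<in>B. ?c b * a b s) = 0" if "s \<in> T" for s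
    proof -
      have "(\<Sum>b\<in>?B. c b * (a b s - a b t / a b0 t * a b0 s)) =
          (\<Sum>b\<in>?B. c b * a b s) - (\<Sum>b\<in>?B. c b * a b t * (a b0 s / a b0 t))"
        by (simp add: right_diff_distrib sum_subtractf mult.assoc)
      also have "(\<Sum>b\<in>?B. c b * a b t * (a b0 s / a b0 t)) = (\<Sum>b\<in>?B. c b * a b t) * (a b0 s / a b0 t)"
        by (rule sum_distrib_right[symmetric])
      finally show ?thesis
        using c0[OF that] unfolding split by simp
    qed
    moreover have "(\<Sum>b\<in>B. ?c b * a b t) = 0"
      using b0(2) unfolding split by simp
    moreover have "\<exists>b\<in>B. ?c b \<noteq> 0"
      using c by auto
    ultimately show ?thesis
      by (intro exI[of _ ?c]) auto
  qed
qed

definition expo :: "'v set \<Rightarrow> ('v \<Rightarrow> nat) \<Rightarrow> 'v \<Rightarrow>\<^sub>0 nat"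
  where "expo V a = (\<Sum>v\<in>V. Poly_Mapping.single v (a v))"

lemma lookup_expo: "finite V \<Longrightarrow> Poly_Mapping.lookup (expo V a) v = (if v \<in> V then a v else 0)"
proof -
  assume "finite V"
  have "Poly_Mapping.lookup (expo V a) v = (\<Sum>u\<in>V. if u = v then a u else 0)"
    unfolding expo_def lookup_sum by (intro sum.cong) (auto simp: lookup_single)
  then show ?thesis
    using \<open>finite V\<close> by simp
qed

lemma keys_expo: "finite V \<Longrightarrow> Poly_Mapping.keys (expo V a) \<subseteq> V"
  by (auto simp: in_keys_iff lookup_expo split: if_splits)

lemma inj_on_expo: "finite V \<Longrightarrow> inj_on (expo V) (V \<rightarrow>\<^sub>E {..<k::nat})"
proof (rule inj_onI)
  fix a b
  assume V: "finite V" and ab: "a \<in> V \<rightarrow>\<^sub>E {..<k}" "b \<in> V \<rightarrow>\<^sub>E {..<k}" "expo V a = expo V b"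
  show "a = b"
  proof (rule PiE_ext[OF ab(1,2)])
    show "a v = b v" if "v \<in> V" for v
      using arg_cong[OF ab(3), of "\<lambda>m. Poly_Mapping.lookup m v"] that V by (simp add: lookup_expo)
  qed
qed

text \<open>Exponents are bounded separately and not in total, because the count is then exactly the
  power \<open>k ^ card V\<close> and no binomial coefficients have to be estimated.\<close>

definition box_monoms :: "'v set \<Rightarrow> nat \<Rightarrow> ('v \<Rightarrow>\<^sub>0 nat) set"
  where "box_monoms V k = {m. Poly_Mapping.keys m \<subseteq> V \<and> (\<forall>v\<in>V. Poly_Mapping.lookup m v < k)}"

lemma box_monoms_eq: "finite V \<Longrightarrow> box_monoms V k = expo V ` (V \<rightarrow>\<^sub>E {..<k})"
proof (intro equalityI subsetI)
  fix m assume V: "finite V" and m: "m \<in> box_monoms V k"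
  have "m = expo V (restrict (Poly_Mapping.lookup m) V)"
    using m V by (intro poly_mapping_eqI) (auto simp: lookup_expo box_monoms_def in_keys_iff)
  then show "m \<in> expo V ` (V \<rightarrow>\<^sub>E {..<k})"
    using m by (auto simp: box_monoms_def)
qed (use keys_expo in \<open>force simp: box_monoms_def lookup_expo PiE_iff\<close>)

lemma finite_box_monoms: "finite V \<Longrightarrow> finite (box_monoms V k)"
  by (simp add: box_monoms_eq finite_PiE)

lemma card_box_monoms: "finite V \<Longrightarrow> card (box_monoms V k) = k ^ card V"
  by (simp add: box_monoms_eq card_image[OF inj_on_expo] card_PiE)

definition exponents_le :: "nat \<Rightarrow> (('v \<Rightarrow>\<^sub>0 nat) \<Rightarrow>\<^sub>0 'k::comm_ring_1) \<Rightarrow> bool"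
  where "exponents_le D p \<longleftrightarrow> (\<forall>m\<in>Poly_Mapping.keys p. \<forall>v. Poly_Mapping.lookup m v \<le> D)"

lemma exponents_le_mono: "exponents_le D p \<Longrightarrow> D \<le> E \<Longrightarrow> exponents_le E p"
  unfolding exponents_le_def by (meson order_trans)

lemma exponents_le_add: "exponents_le D p \<Longrightarrow> exponents_le D q \<Longrightarrow> exponents_le D (p + q)"
  using keys_add[of p q] by (auto simp: exponents_le_def)

lemma exponents_le_mult:
  assumes "exponents_le D p" "exponents_le E q"
  shows "exponents_le (D + E) (p * q)"
  unfolding exponents_le_def
proof (intro ballI allI)
  fix m v assume "m \<in> Poly_Mapping.keys (p * q)"
  then obtain a b where "m = a + b" "a \<in> Poly_Mapping.keys p" "b \<in> Poly_Mapping.keys q"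
    using keys_mult[of p q] by auto
  then show "Poly_Mapping.lookup m v \<le> D + E"
    using assms by (simp add: exponents_le_def lookup_add add_mono)
qed

lemma exponents_le_one: "exponents_le D 1"
  by (simp add: exponents_le_def)

lemma exponents_le_power: "exponents_le D p \<Longrightarrow> exponents_le (k * D) (p ^ k)"
  by (induction k) (auto simp: exponents_le_one exponents_le_mult)

lemma exponents_le_prod:
  "(\<And>i. i \<in> A \<Longrightarrow> exponents_le D (f i)) \<Longrightarrow> exponents_le (card A * D) (prod f A)"
  by (induction A rule: infinite_finite_induct) (auto simp: exponents_le_one exponents_le_mult)

lemma exponents_le_exists: "\<exists>D. exponents_le D p"
proof (induction p rule: poly_mapping_single_induct)
  case (single m c)
  have "Poly_Mapping.lookup m v \<le> (\<Sum>u\<in>Poly_Mapping.keys m. Poly_Mapping.lookup m u)" for v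
    by (cases "v \<in> Poly_Mapping.keys m") (auto intro: member_le_sum simp: in_keys_iff)
  then show ?case
    by (auto simp: exponents_le_def)
next
  case (add p q)
  then show ?case
    by (meson exponents_le_add exponents_le_mono max.cobounded1 max.cobounded2)
qed

section \<open>Algebraic independence and the length of prime chains\<close>

definition alg_indep_mod :: "(('v \<Rightarrow>\<^sub>0 nat) \<Rightarrow>\<^sub>0 'k::comm_ring_1) set \<Rightarrow> nat \<Rightarrow> (nat \<Rightarrow> ('v \<Rightarrow>\<^sub>0 nat) \<Rightarrow>\<^sub>0 'k) \<Rightarrow> bool"
  where "alg_indep_mod Q r y \<longleftrightarrow> (\<forall>q\<in>carrier (poly_ring {..<r}). subst y q \<in> Q \<longrightarrow> q = 0)"

text \<open>Products of powers \<open>< k\<close> of the \<open>y i\<close> give \<open>k\<^sup>r\<close> independent elements of a space of dimension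
  \<open>O(k\<^bsup>card V\<^esup>)\<close>.\<close>

lemma alg_indep_mod_bound:
  fixes y :: "nat \<Rightarrow> ('v \<Rightarrow>\<^sub>0 nat) \<Rightarrow>\<^sub>0 'k::field"
  assumes V: "finite V" and y: "\<And>i. i < r \<Longrightarrow> y i \<in> carrier (poly_ring V)"
    and indep: "alg_indep_mod Q r y" and Q: "0 \<in> Q"
  shows "r \<le> card V"
proof (rule ccontr)
  assume "\<not> r \<le> card V"
  then have r: "Suc (card V) \<le> r"
    by simp
  have "\<forall>i. \<exists>D. exponents_le D (y i)"
    using exponents_le_exists by blast
  then obtain D where D: "\<And>i. exponents_le (D i) (y i)"
    by metis
  define d where "d = (\<Sum>i<r. D i)"
  have d: "exponents_le d (y i)" if "i < r" for i
    using that by (intro exponents_le_mono[OF D]) (auto simp: d_def intro: member_le_sum)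
  \<comment> \<open>With this \<open>k\<close> the factor \<open>(r * d + 1) ^ card V\<close> is
    below \<open>k\<close>. So the monomials that can occur, at most
    \<open>k ^ card V * (r * d + 1) ^ card V\<close>, are fewer than
    \<open>k ^ Suc (card V)\<close>.\<close>
  define k where "k = Suc ((r * d + 1) ^ card V)"
  let ?A = "box_monoms {..<r} k" and ?T = "box_monoms V (r * (k * d) + 1)"
  let ?z = "subst_monom y"
  have z_bound: "exponents_le (r * (k * d)) (?z m)" if "m \<in> ?A" for m
  proof -
    have "exponents_le (k * d) (y i ^ Poly_Mapping.lookup m i)" if "i < r" for i
      using \<open>m \<in> ?A\<close> that exponents_le_power[OF d[OF that]]
      by (rule_tac exponents_le_mono) (auto simp: box_monoms_def less_imp_le)
    then show ?thesis
      using that exponents_le_prod[of "{..<r}" "k * d" "\<lambda>i. y i ^ Poly_Mapping.lookup m i"]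
      by (simp add: box_monoms_def subst_monom_superset[of "{..<r}"])
  qed
  have z_closed: "?z m \<in> carrier (poly_ring V)" if "m \<in> ?A" for m
    unfolding subst_monom_def using that
    by (intro poly_ring_prod poly_ring_power y) (auto simp: box_monoms_def)
  have "(r * (k * d) + 1) ^ card V \<le> (k * (r * d + 1)) ^ card V"
    by (intro power_mono) (auto simp: k_def algebra_simps)
  also have "\<dots> < k ^ card V * k"
    by (subst power_mult_distrib, intro mult_strict_left_mono) (simp_all add: k_def)
  also have "\<dots> \<le> k ^ r"
    using power_increasing[OF r, of k] by (simp add: k_def mult.commute)
  finally have "card ?T < card ?A"
    using V by (simp add: card_box_monoms)
  then obtain c where c: "\<exists>b\<in>?A. c b \<noteq> 0"
    and c0: "\<And>t. t \<in> ?T \<Longrightarrow> (\<Sum>b\<in>?A. c b * Poly_Mapping.lookup (?z b) t) = 0"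
    using homogeneous_system_nontrivial[of ?T ?A "\<lambda>b. Poly_Mapping.lookup (?z b)"] V
    by (auto simp: finite_box_monoms)
  \<comment> \<open>A linear relation between products of powers of the \<open>y i\<close> is a
    polynomial relation between the \<open>y i\<close> with the same coefficients.\<close>
  let ?q = "\<Sum>b\<in>?A. Poly_Mapping.single b (c b)"
  have sub: "subst y ?q = (\<Sum>b\<in>?A. Poly_Mapping.single 0 (c b) * ?z b)"
    by (simp add: subst_sum subst_single)
  have "subst y ?q = 0"
  proof (rule poly_mapping_eqI)
    fix t
    have "Poly_Mapping.lookup (?z b) t = 0" if "b \<in> ?A" "t \<notin> ?T" for b
    proof (rule ccontr)
      assume "Poly_Mapping.lookup (?z b) t \<noteq> 0"
      then have "t \<in> Poly_Mapping.keys (?z b)"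
        by (simp add: in_keys_iff)
      then have "t \<in> ?T"
        using z_bound[OF that(1)] z_closed[OF that(1)]
        by (auto simp: exponents_le_def poly_ring_carrier_iff box_monoms_def less_Suc_eq_le)
      then show False
        using that by simp
    qed
    then have "(\<Sum>b\<in>?A. c b * Poly_Mapping.lookup (?z b) t) = 0"
      using c0[of t] by (cases "t \<in> ?T") auto
    moreover have "Poly_Mapping.lookup (Poly_Mapping.single 0 (c b) * ?z b) t = c b * Poly_Mapping.lookup (?z b) t" for b
      by (simp add: Poly_Mapping.map.rep_eq when_def flip: mult_map_scale_conv_mult)
    ultimately show "Poly_Mapping.lookup (subst y ?q) t = Poly_Mapping.lookup 0 t"
      by (simp add: sub lookup_sum)
  qed
  moreover have "?q \<in> carrier (poly_ring {..<r})"
    by (intro poly_ring_sum) (auto simp: poly_ring_carrier_iff box_monoms_def)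
  ultimately have "?q = 0"
    using indep Q by (simp add: alg_indep_mod_def)
  moreover have "Poly_Mapping.lookup ?q b = c b" if "b \<in> ?A" for b
  proof -
    have "Poly_Mapping.lookup ?q b = (\<Sum>a\<in>?A. if a = b then c a else 0)"
      unfolding lookup_sum by (intro sum.cong) (auto simp: lookup_single)
    then show ?thesis
      using that by (simp add: finite_box_monoms)
  qed
  ultimately show False
    using c by simp
qed

text \<open>Division by the last variable. The drop of its exponent in \<open>q1\<close> drives the
  induction in \<open>alg_indep_mod_extend\<close>.\<close>

lemma split_last_variable:
  fixes c :: "(nat \<Rightarrow>\<^sub>0 nat) \<Rightarrow> 'k::comm_ring_1"
  assumes "finite A"
    and "\<And>m. m \<in> A \<Longrightarrow> Poly_Mapping.keys m \<subseteq> {..<Suc r} \<and> Poly_Mapping.lookup m r \<le> Suc d"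
  shows "\<exists>q0\<in>carrier (poly_ring {..<r}). \<exists>q1\<in>carrier (poly_ring {..<Suc r}).
    (\<Sum>m\<in>A. Poly_Mapping.single m (c m)) = q0 + var r * q1 \<and> (\<forall>m\<in>Poly_Mapping.keys q1. Poly_Mapping.lookup m r \<le> d)"
  using assms
proof (induction A rule: finite_induct)
  case empty
  show ?case
    by (intro bexI[of _ 0]) (auto simp: poly_ring_zero)
next
  case (insert m A)
  then obtain q0 q1 where q: "q0 \<in> carrier (poly_ring {..<r})" "q1 \<in> carrier (poly_ring {..<Suc r})"
      "(\<Sum>m\<in>A. Poly_Mapping.single m (c m)) = q0 + var r * q1"
      "\<And>m. m \<in> Poly_Mapping.keys q1 \<Longrightarrow> Poly_Mapping.lookup m r \<le> d"
    by blast
  have m: "Poly_Mapping.keys m \<subseteq> {..<Suc r}" "Poly_Mapping.lookup m r \<le> Suc d"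
    using insert.prems by auto
  show ?case
  proof (cases "Poly_Mapping.lookup m r = 0")
    case True
    then have "r \<notin> Poly_Mapping.keys m"
      by (simp add: in_keys_iff)
    then have "Poly_Mapping.keys m \<subseteq> {..<r}"
      using m by (auto simp: less_Suc_eq)
    then have "Poly_Mapping.single m (c m) + q0 \<in> carrier (poly_ring {..<r})"
      by (intro poly_ring_add q) (auto simp: poly_ring_carrier_iff)
    then show ?thesis
      using q insert.hyps by (intro bexI[of _ "Poly_Mapping.single m (c m) + q0"] bexI[of _ q1]) auto
  next
    case False
    let ?m = "m - Poly_Mapping.single r 1"
    have eq: "m = Poly_Mapping.single r 1 + ?m"
      using False by (intro poly_mapping_eqI) (auto simp: lookup_add lookup_minus lookup_single when_def)
    have lk: "Poly_Mapping.lookup ?m i \<le> Poly_Mapping.lookup m i" for i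
      by (simp add: lookup_minus)
    then have "Poly_Mapping.keys ?m \<subseteq> Poly_Mapping.keys m"
      by (metis in_keys_iff le_zero_eq subsetI)
    then have 1: "Poly_Mapping.single ?m (c m) + q1 \<in> carrier (poly_ring {..<Suc r})"
      using m by (intro poly_ring_add q) (auto simp: poly_ring_carrier_iff)
    have "Poly_Mapping.single m (c m) = var r * Poly_Mapping.single ?m (c m)"
      using eq by (simp add: var_def mult_single)
    then have 2: "(\<Sum>m\<in>insert m A. Poly_Mapping.single m (c m)) = q0 + var r * (Poly_Mapping.single ?m (c m) + q1)"
      using insert.hyps q by (simp add: algebra_simps)
    have "Poly_Mapping.lookup ?m r \<le> d"
      using m(2) by (simp add: lookup_minus)
    then have "\<forall>a\<in>Poly_Mapping.keys (Poly_Mapping.single ?m (c m) + q1). Poly_Mapping.lookup a r \<le> d"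
      using q(4) keys_add[of "Poly_Mapping.single ?m (c m)" q1] by (auto split: if_splits)
    then show ?thesis
      using 1 2 q(1) by blast
  qed
qed

text \<open>Descending to a smaller prime raises the transcendence degree of the quotient. In a
  relation q0 + f q1 modulo \<open>P\<close>, reduction modulo \<open>Q\<close> removes f q1 and
  forces q0 = 0. Then \<open>f\<close> cancels, as it is outside the prime \<open>P\<close>, and q1
  has smaller degree in the new variable.\<close>

lemma alg_indep_mod_extend:
  fixes Q P :: "(('v \<Rightarrow>\<^sub>0 nat) \<Rightarrow>\<^sub>0 'k::comm_ring_1) set"
  assumes Q: "prime_subset Q" and P: "prime_subset P" and PQ: "P \<subseteq> Q" and f: "f \<in> Q" "f \<notin> P"
    and indep: "alg_indep_mod Q r y"
  shows "alg_indep_mod P (Suc r) (y(r := f))"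
proof -
  interpret Q: prime_subset Q by fact
  interpret P: prime_subset P by fact
  let ?y = "y(r := f)"
  have low: "subst ?y q = subst y q" if "q \<in> carrier (poly_ring {..<r})" for q
    using that by (rule subst_cong) auto
  have "q = 0" if "q \<in> carrier (poly_ring {..<Suc r})" "subst ?y q \<in> P"
    "\<forall>m\<in>Poly_Mapping.keys q. Poly_Mapping.lookup m r \<le> d" for q d
    using that
  proof (induction d arbitrary: q)
    case 0
    have "Poly_Mapping.keys m \<subseteq> {..<r}" if "m \<in> Poly_Mapping.keys q" for m
    proof -
      have "Poly_Mapping.keys m \<subseteq> {..<Suc r}" "r \<notin> Poly_Mapping.keys m"
        using 0(1,3) that by (auto simp: poly_ring_carrier_iff in_keys_iff)
      then show ?thesis
        by (auto simp: less_Suc_eq)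
    qed
    then have "q \<in> carrier (poly_ring {..<r})"
      by (simp add: poly_ring_carrier_iff)
    then show ?case
      using 0(2) indep PQ unfolding alg_indep_mod_def by (metis low subsetD)
  next
    case (Suc d)
    obtain q0 q1 where q: "q0 \<in> carrier (poly_ring {..<r})" "q1 \<in> carrier (poly_ring {..<Suc r})"
      "q = q0 + var r * q1" "\<forall>m\<in>Poly_Mapping.keys q1. Poly_Mapping.lookup m r \<le> d"
      using split_last_variable[of "Poly_Mapping.keys q" r d "Poly_Mapping.lookup q"] Suc.prems(1,3)
      unfolding poly_mapping_sum_single[of q, symmetric] by (auto simp: poly_ring_carrier_iff)
    have eq: "subst ?y q = subst y q0 + f * subst ?y q1"
      by (simp add: q(3) subst_simps low[OF q(1)])
    have "subst ?y q - f * subst ?y q1 \<in> Q"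
      using Suc.prems(2) PQ by (intro Q.diff_mem Q.mult_mem_right f(1)) blast
    then have "subst y q0 \<in> Q"
      by (simp add: eq)
    then have "q0 = 0"
      using indep q(1) by (simp add: alg_indep_mod_def)
    then have "f * subst ?y q1 \<in> P"
      using Suc.prems(2) unfolding eq by simp
    then have "subst ?y q1 \<in> P"
      using f(2) P.prime_mem by blast
    then have "q1 = 0"
      by (rule Suc.IH[OF q(2) _ q(4)])
    then show ?case
      using q(3) \<open>q0 = 0\<close> by simp
  qed
  moreover have "\<exists>d. \<forall>m\<in>Poly_Mapping.keys q. Poly_Mapping.lookup m r \<le> d" for q :: "(nat \<Rightarrow>\<^sub>0 nat) \<Rightarrow>\<^sub>0 'k"
    using exponents_le_exists[of q] by (auto simp: exponents_le_def)
  ultimately show ?thesis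
    unfolding alg_indep_mod_def by metis
qed

text \<open>Without variables \<open>q\<close> is a constant, and a nonzero constant is a unit,
  which no proper ideal contains.\<close>

lemma alg_indep_mod_0:
  fixes Q :: "(('v \<Rightarrow>\<^sub>0 nat) \<Rightarrow>\<^sub>0 'k::field) set"
  assumes "prime_subset Q"
  shows "alg_indep_mod Q 0 y"
  unfolding alg_indep_mod_def
proof (intro ballI impI)
  interpret prime_subset Q by fact
  fix q :: "(nat \<Rightarrow>\<^sub>0 nat) \<Rightarrow>\<^sub>0 'k"
  assume q: "q \<in> carrier (poly_ring {..<0})" "subst y q \<in> Q"
  then have "q = Poly_Mapping.single 0 (Poly_Mapping.lookup q 0)"
    by (intro poly_mapping_eqI) (auto simp: poly_ring_carrier_iff in_keys_iff lookup_single when_def)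
  then obtain c where c: "q = Poly_Mapping.single 0 c"
    by blast
  show "q = 0"
  proof (rule ccontr)
    assume "q \<noteq> 0"
    then have "c \<noteq> 0"
      using c by auto
    then have "1 = Poly_Mapping.single 0 (inverse c) * subst y q"
      by (simp add: c mult_single)
    then show False
      using mult_mem[OF q(2)] one_not_mem by metis
  qed
qed

text \<open>One element from each gap, chosen from the top of the chain downwards, gives
  \<open>h\<close> elements that are independent modulo the bottom prime.\<close>

lemma prime_chain_length_le:
  fixes c :: "nat \<Rightarrow> (('v \<Rightarrow>\<^sub>0 nat) \<Rightarrow>\<^sub>0 'k::field) set"
  assumes V: "finite V" and c: "prime_chain (poly_ring V) c h"
  shows "h \<le> card V"
proof -
  have prime: "primeideal (c i) (poly_ring V)" if "i \<le> h" for i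
    using c that by (simp add: prime_chain_def)
  have strict: "c i \<subset> c (Suc i)" if "i < h" for i
    using c that by (simp add: prime_chain_def)
  have "\<exists>y. (\<forall>i<j. y i \<in> carrier (poly_ring V)) \<and> alg_indep_mod (lift_ideal V (c (h - j))) j y"
    if "j \<le> h" for j
    using that
  proof (induction j)
    case 0
    then show ?case
      using alg_indep_mod_0[OF prime_subset_lift_ideal[OF prime[of h]]] by auto
  next
    case (Suc j)
    then obtain y where y: "\<forall>i<j. y i \<in> carrier (poly_ring V)"
      "alg_indep_mod (lift_ideal V (c (h - j))) j y"
      by auto
    have eq: "h - j = Suc (h - Suc j)"
      using Suc.prems by simp
    obtain f where f: "f \<in> c (h - j)" "f \<notin> c (h - Suc j)"
      using strict[of "h - Suc j"] Suc.prems unfolding eq by auto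
    have fV: "f \<in> carrier (poly_ring V)"
      using f(1) ideal_poly_ringD(1)[OF primeideal.axioms(1)[OF prime[of "h - j"]]] by auto
    have "alg_indep_mod (lift_ideal V (c (h - Suc j))) (Suc j) (y(j := f))"
    proof (rule alg_indep_mod_extend[OF _ _ _ _ _ y(2)])
      show "lift_ideal V (c (h - Suc j)) \<subseteq> lift_ideal V (c (h - j))"
        using strict[of "h - Suc j"] Suc.prems unfolding eq by (intro lift_ideal_mono) auto
    qed (use f fV in \<open>auto simp: mem_lift_ideal_iff prime intro: prime_subset_lift_ideal\<close>)
    moreover have "\<forall>i<Suc j. (y(j := f)) i \<in> carrier (poly_ring V)"
      using y(1) fV by (auto simp: less_Suc_eq)
    ultimately show ?case
      by blast
  qed
  from this[of h] obtain y where "\<forall>i<h. y i \<in> carrier (poly_ring V)"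
    "alg_indep_mod (lift_ideal V (c 0)) h y"
    by auto
  then show ?thesis
    using alg_indep_mod_bound[of V h y] V
      prime_subset.zero_mem[OF prime_subset_lift_ideal[OF prime[of 0]]] by auto
qed

section \<open>Lower bound for the number of generators up to radical\<close>

lemma lookup_const_times:
  "Poly_Mapping.lookup (Poly_Mapping.single 0 c * p) t = c * Poly_Mapping.lookup p t"
  by (simp add: Poly_Mapping.map.rep_eq when_def flip: mult_map_scale_conv_mult)

text \<open>Combinations are indexed by \<open>A\<close> and not by the image, so repeated
  generators need no separate treatment.\<close>

lemma mem_Idl_imageD:
  assumes f: "\<And>i. i \<in> A \<Longrightarrow> f i \<in> carrier (poly_ring V)" and "finite A"
    and p: "p \<in> Idl\<^bsub>poly_ring V\<^esub> (f ` A)"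
  shows "\<exists>g. (\<forall>i\<in>A. g i \<in> carrier (poly_ring V)) \<and> p = (\<Sum>i\<in>A. f i * g i)"
proof -
  interpret cring "poly_ring V" by (rule cring_poly_ring)
  let ?I = "{p. \<exists>g. (\<forall>i\<in>A. g i \<in> carrier (poly_ring V)) \<and> p = (\<Sum>i\<in>A. f i * g i)}"
  have "ideal ?I (poly_ring V)"
  proof (rule ideal_poly_ringI)
    show "?I \<subseteq> carrier (poly_ring V)"
      using f by (auto intro!: poly_ring_sum poly_ring_mult)
    show "0 \<in> ?I"
      by (auto intro!: exI[of _ "\<lambda>_. 0"] simp: poly_ring_zero)
    fix a assume "a \<in> ?I"
    then obtain g where g: "\<forall>i\<in>A. g i \<in> carrier (poly_ring V)" "a = (\<Sum>i\<in>A. f i * g i)"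
      by blast
    show "r * a \<in> ?I" if "r \<in> carrier (poly_ring V)" for r
      using that g by (auto intro!: exI[of _ "\<lambda>i. r * g i"] poly_ring_mult simp: sum_distrib_left ac_simps)
    show "a + b \<in> ?I" if b: "b \<in> ?I" for b
    proof -
      obtain h where "\<forall>i\<in>A. h i \<in> carrier (poly_ring V)" "b = (\<Sum>i\<in>A. f i * h i)"
        using b by blast
      then show ?thesis
        using g by (auto intro!: exI[of _ "\<lambda>i. g i + h i"] poly_ring_add simp: distrib_left sum.distrib)
    qed
  qed
  moreover have "f ` A \<subseteq> ?I"
  proof
    fix x assume "x \<in> f ` A"
    then obtain j where j: "j \<in> A" "x = f j"
      by blast
    have "(\<Sum>i\<in>A. f i * (if i = j then 1 else 0)) = (\<Sum>i\<in>A. if i = j then f i else 0)"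
      by (intro sum.cong) auto
    then have "x = (\<Sum>i\<in>A. f i * (if i = j then 1 else 0))"
      using j \<open>finite A\<close> by simp
    then show "x \<in> ?I"
      by (auto intro!: exI[of _ "\<lambda>i. if i = j then 1 else 0"] simp: poly_ring_zero poly_ring_one)
  qed
  ultimately have "Idl\<^bsub>poly_ring V\<^esub> (f ` A) \<subseteq> ?I"
    by (rule genideal_minimal)
  then show ?thesis
    using p by blast
qed

lemma sum_mem_if_add_closed:
  assumes "0 \<in> U" "\<And>p q. p \<in> U \<Longrightarrow> q \<in> U \<Longrightarrow> p + q \<in> U" "\<And>x. x \<in> A \<Longrightarrow> g x \<in> U"
  shows "sum g A \<in> U"
  using assms(3) by (induction A rule: infinite_finite_induct) (auto intro: assms(1,2))

text \<open>Let \<open>\<mm>\<close> be the ideal of the variables.  Modulo a high power of \<open>\<mm>\<close>, every polynomial is a linear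
  combination of the products of boundedly many monomials with the monomials in the \<open>f i\<close>.  Hence the
  Hilbert function of \<open>\<mm>\<close>, a polynomial of degree \<open>card V\<close>, grows at most like a polynomial of degree \<open>r\<close>.\<close>

lemma card_le_number_of_generators:
  fixes f :: "nat \<Rightarrow> ('v \<Rightarrow>\<^sub>0 nat) \<Rightarrow>\<^sub>0 'k::field"
  assumes V: "finite V" and f: "\<And>i. i \<in> {1..r} \<Longrightarrow> f i \<in> carrier (poly_ring V)"
    and f0: "\<And>i. i \<in> {1..r} \<Longrightarrow> Poly_Mapping.lookup (f i) 0 = 0"
    and pow: "\<And>v. v \<in> V \<Longrightarrow> \<exists>N. var v ^ N \<in> Idl\<^bsub>poly_ring V\<^esub> (f ` {1..r})"
  shows "card V \<le> r"
proof (rule ccontr)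
  assume "\<not> card V \<le> r"
  then have r: "Suc r \<le> card V"
    by simp
  interpret cring "poly_ring V :: (('v \<Rightarrow>\<^sub>0 nat) \<Rightarrow>\<^sub>0 'k) ring" by (rule cring_poly_ring)
  let ?C = "carrier (poly_ring V) :: (('v \<Rightarrow>\<^sub>0 nat) \<Rightarrow>\<^sub>0 'k) set"
  let ?J = "Idl\<^bsub>poly_ring V\<^esub> (f ` {1..r})"
  have J: "ideal ?J (poly_ring V)"
    using f by (intro genideal_ideal) auto
  obtain N' where N': "\<And>v. v \<in> V \<Longrightarrow> var v ^ N' v \<in> ?J"
    using pow by metis
  define N where "N = (\<Sum>v\<in>V. N' v)"
  have N: "var v ^ N \<in> ?J" if "v \<in> V" for v
  proof -
    have "N' v \<le> N"
      unfolding N_def using V that by (intro member_le_sum) auto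
    then have "(var v ^ N :: ('v \<Rightarrow>\<^sub>0 nat) \<Rightarrow>\<^sub>0 'k) = var v ^ (N - N' v) * var v ^ N' v"
      by (simp flip: power_add)
    then show ?thesis
      using ideal_poly_ringD(4)[OF J N'[OF that]] that by (simp add: poly_ring_power var_in_carrier)
  qed
  define W where "W = box_monoms V N"
  have finW: "finite W"
    using V by (simp add: W_def finite_box_monoms)
  \<comment> \<open>A monomial outside \<open>W\<close> is divisible by some
    \<open>var v ^ N\<close> and hence lies in \<open>?J\<close>; so the finitely many monomials in
    \<open>W\<close> span the ring modulo \<open>?J\<close>.\<close>
  have decomp: "\<exists>g. (\<forall>i\<in>{1..r}. g i \<in> ?C) \<and>
      p = (\<Sum>w\<in>W. Poly_Mapping.single w (Poly_Mapping.lookup p w)) + (\<Sum>i=1..r. f i * g i)"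
    if p: "p \<in> ?C" for p
  proof -
    let ?s = "\<lambda>m. Poly_Mapping.single m (Poly_Mapping.lookup p m)"
    have "?s m \<in> ?J" if m: "m \<in> Poly_Mapping.keys p - W" for m
    proof -
      have mV: "Poly_Mapping.keys m \<subseteq> V"
        using m p by (auto simp: poly_ring_carrier_iff)
      then obtain v where v: "v \<in> V" "N \<le> Poly_Mapping.lookup m v"
        using m by (force simp: W_def box_monoms_def not_less)
      let ?m = "m - Poly_Mapping.single v N"
      have eq: "m = ?m + Poly_Mapping.single v N"
        using v by (intro poly_mapping_eqI) (auto simp: lookup_add lookup_minus lookup_single when_def)
      have "var v ^ N = Poly_Mapping.single (Poly_Mapping.single v N) (1::'k)"
        using single_eq_const_times_monom[of "Poly_Mapping.single v N" "1::'k"]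
        by (simp add: subst_monom_superset[of "{v}"])
      then have "?s m = Poly_Mapping.single ?m (Poly_Mapping.lookup p m) * var v ^ N"
        using eq by (simp add: mult_single)
      moreover have "Poly_Mapping.keys ?m \<subseteq> V"
        using mV by (auto simp: in_keys_iff lookup_minus)
      then have "Poly_Mapping.single ?m (Poly_Mapping.lookup p m) \<in> ?C"
        by (auto simp: poly_ring_carrier_iff)
      ultimately show ?thesis
        using ideal_poly_ringD(4)[OF J N[OF v(1)]] by simp
    qed
    then have sum_J: "(\<Sum>m\<in>Poly_Mapping.keys p - W. ?s m) \<in> ?J"
      by (rule ideal_poly_ring_sum[OF J])
    obtain g where g: "\<forall>i\<in>{1..r}. g i \<in> ?C" "(\<Sum>m\<in>Poly_Mapping.keys p - W. ?s m) = (\<Sum>i=1..r. f i * g i)"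
      using mem_Idl_imageD[OF f finite_atLeastAtMost sum_J] by blast
    have "p = (\<Sum>m\<in>Poly_Mapping.keys p. ?s m)"
      by (rule poly_mapping_sum_single)
    also have "\<dots> = (\<Sum>m\<in>Poly_Mapping.keys p \<inter> W. ?s m) + (\<Sum>m\<in>Poly_Mapping.keys p - W. ?s m)"
      by (rule sum.Int_Diff) simp
    also have "(\<Sum>m\<in>Poly_Mapping.keys p \<inter> W. ?s m) = (\<Sum>m\<in>W. ?s m)"
      using finW by (intro sum.mono_neutral_left) (auto simp: in_keys_iff)
    finally show ?thesis
      using g by auto
  qed
  \<comment> \<open>The box of side \<open>k\<close> has \<open>k ^ card V\<close> monomials, all of
    weight below \<open>K\<close>. The index set \<open>T\<close> has
    \<open>card W * card V ^ r * k ^ r\<close> elements, fewer than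
    \<open>k ^ Suc r\<close>.\<close>
  define k where "k = Suc (card W * card V ^ r)"
  define K where "K = card V * k"
  define wt where "wt = (\<lambda>m :: 'v \<Rightarrow>\<^sub>0 nat. \<Sum>v\<in>V. Poly_Mapping.lookup m v)"
  have wt_add: "wt (a + b) = wt a + wt b" for a b
    by (simp add: wt_def lookup_add sum.distrib)
  define F where "F = (\<lambda>b::nat \<Rightarrow> nat. \<Prod>i=1..r. f i ^ b i)"
  define G where "G = (\<lambda>t. Poly_Mapping.single (fst t) 1 * F (snd t))"
  define T where "T = W \<times> ({1..r} \<rightarrow>\<^sub>E {..<K})"
  have finT: "finite T"
    by (simp add: T_def finW finite_PiE)
  \<comment> \<open>Polynomials that are linear combinations of the \<open>G t\<close> up to terms
    of weight at least \<open>K\<close>. This truncation is what makes finitely many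
    \<open>t\<close> enough.\<close>
  define U where "U = {p. \<exists>\<alpha>. \<forall>m. wt m < K \<longrightarrow>
    Poly_Mapping.lookup p m = (\<Sum>t\<in>T. \<alpha> t * Poly_Mapping.lookup (G t) m)}"
  have U_add: "p + q \<in> U" if pq: "p \<in> U" "q \<in> U" for p q
  proof -
    obtain \<alpha> \<beta> where "\<forall>m. wt m < K \<longrightarrow> Poly_Mapping.lookup p m = (\<Sum>t\<in>T. \<alpha> t * Poly_Mapping.lookup (G t) m)"
      "\<forall>m. wt m < K \<longrightarrow> Poly_Mapping.lookup q m = (\<Sum>t\<in>T. \<beta> t * Poly_Mapping.lookup (G t) m)"
      using pq unfolding U_def by blast
    then show ?thesis
      unfolding U_def
      by (auto intro!: exI[of _ "\<lambda>t. \<alpha> t + \<beta> t"] simp: lookup_add distrib_right sum.distrib)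
  qed
  have U_order: "p \<in> U" if order: "\<And>m. m \<in> Poly_Mapping.keys p \<Longrightarrow> K \<le> wt m" for p
  proof -
    have "Poly_Mapping.lookup p m = 0" if "wt m < K" for m
      using order[of m] that by (meson in_keys_iff not_less)
    then show ?thesis
      unfolding U_def by (auto intro!: exI[of _ "\<lambda>_. 0"])
  qed
  have U_zero: "0 \<in> U"
    by (rule U_order) simp
  have U_term: "Poly_Mapping.single w c * F b \<in> U" if "(w, b) \<in> T" for w c b
  proof -
    have "Poly_Mapping.single w c * F b = Poly_Mapping.single 0 c * G (w, b)"
      by (simp add: G_def mult_single flip: mult.assoc)
    then have "Poly_Mapping.lookup (Poly_Mapping.single w c * F b) m
        = (\<Sum>t\<in>T. (if t = (w, b) then c else 0) * Poly_Mapping.lookup (G t) m)" for m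
      using that finT by (simp add: lookup_const_times if_distrib[of "\<lambda>x. x * _"] cong: if_cong)
    then show ?thesis
      unfolding U_def by (auto intro!: exI[of _ "\<lambda>t. if t = (w, b) then c else 0"])
  qed
  have order_mult: "a + b \<le> wt m"
    if m: "m \<in> Poly_Mapping.keys (p * q)"
      and "\<And>m. m \<in> Poly_Mapping.keys p \<Longrightarrow> a \<le> wt m" "\<And>m. m \<in> Poly_Mapping.keys q \<Longrightarrow> b \<le> wt m"
    for a b m and p q :: "('v \<Rightarrow>\<^sub>0 nat) \<Rightarrow>\<^sub>0 'k"
  proof -
    obtain x y where "m = x + y" "x \<in> Poly_Mapping.keys p" "y \<in> Poly_Mapping.keys q"
      using m keys_mult[of p q] by auto
    then show ?thesis
      using that by (simp add: wt_add add_mono)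
  qed
  \<comment> \<open>The missing constant terms enter here. As a consequence, \<open>F b\<close> has
    order at least the sum of the exponents \<open>b i\<close>.\<close>
  have order_f: "1 \<le> wt m" if "i \<in> {1..r}" "m \<in> Poly_Mapping.keys (f i)" for i m
  proof -
    have "m \<noteq> 0"
      using f0[OF that(1)] that(2) by (auto simp: in_keys_iff)
    then obtain v where v: "v \<in> Poly_Mapping.keys m"
      by fastforce
    then have "v \<in> V"
      using f[OF that(1)] that(2) by (auto simp: poly_ring_carrier_iff)
    then have "Poly_Mapping.lookup m v \<le> wt m"
      unfolding wt_def using V by (intro member_le_sum) auto
    then show ?thesis
      using v by (simp add: in_keys_iff)
  qed
  have order_fpow: "e \<le> wt m" if "i \<in> {1..r}" "m \<in> Poly_Mapping.keys (f i ^ e)" for i m e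
    using that(2)
  proof (induction e arbitrary: m)
    case (Suc e)
    then show ?case
      using order_mult[of m "f i" "f i ^ e" 1 e] order_f[OF that(1)] by auto
  qed simp
  have order_F: "(\<Sum>i\<in>A. b i) \<le> wt m" if "A \<subseteq> {1..r}" "m \<in> Poly_Mapping.keys (\<Prod>i\<in>A. f i ^ b i)" for A b m
  proof -
    have "finite A"
      using that(1) finite_subset by blast
    then show ?thesis
      using that
    proof (induction A arbitrary: m rule: finite_induct)
      case (insert i A)
      then show ?case
        using order_mult[of m "f i ^ b i" "\<Prod>i\<in>A. f i ^ b i" "b i" "\<Sum>i\<in>A. b i"]
          order_fpow[of i _ "b i"] by auto
    qed simp
  qed
  have F_step: "F b * f i = F (b(i := Suc (b i)))" if "i \<in> {1..r}" for b i
  proof -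
    have "F b = f i ^ b i * (\<Prod>j\<in>{1..r} - {i}. f j ^ b j)"
      unfolding F_def using that by (subst prod.remove[of _ i]) auto
    moreover have "F (b(i := Suc (b i))) = f i ^ Suc (b i) * (\<Prod>j\<in>{1..r} - {i}. f j ^ b j)"
      unfolding F_def using that by (subst prod.remove[of _ i]) auto
    ultimately show ?thesis
      by (simp add: ac_simps)
  qed
  \<comment> \<open>Expanding \<open>p\<close> by \<open>decomp\<close> leaves terms in which one
    exponent of \<open>F b\<close> has grown. After at most \<open>K\<close> rounds their order
    reaches \<open>K\<close>, and the truncation absorbs them.\<close>
  have U_F: "F b * p \<in> U" if "b \<in> {1..r} \<rightarrow>\<^sub>E UNIV" "p \<in> ?C" for b p
    using that
  proof (induction "K - (\<Sum>i=1..r. b i)" arbitrary: b p rule: less_induct)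
    case less
    show ?case
    proof (cases "K \<le> (\<Sum>i=1..r. b i)")
      case True
      show ?thesis
      proof (rule U_order)
        fix m assume "m \<in> Poly_Mapping.keys (F b * p)"
        then have "(\<Sum>i=1..r. b i) + 0 \<le> wt m"
          by (rule order_mult) (auto simp: F_def order_F)
        then show "K \<le> wt m"
          using True by simp
      qed
    next
      case False
      obtain g where g: "\<forall>i\<in>{1..r}. g i \<in> ?C"
        "p = (\<Sum>w\<in>W. Poly_Mapping.single w (Poly_Mapping.lookup p w)) + (\<Sum>i=1..r. f i * g i)"
        using decomp[OF less.prems(2)] by blast
      have "b i < K" if "i \<in> {1..r}" for i
        using member_le_sum[of i "{1..r}" b] that False by simp
      then have b: "b \<in> {1..r} \<rightarrow>\<^sub>E {..<K}"
        using less.prems(1) by (auto simp: PiE_iff)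
      have "F b * p = F b * (\<Sum>w\<in>W. Poly_Mapping.single w (Poly_Mapping.lookup p w)) + F b * (\<Sum>i=1..r. f i * g i)"
        by (subst g(2)) (rule distrib_left)
      also have "\<dots> = (\<Sum>w\<in>W. Poly_Mapping.single w (Poly_Mapping.lookup p w) * F b)
          + (\<Sum>i=1..r. F (b(i := Suc (b i))) * g i)"
        by (simp add: sum_distrib_left F_step[symmetric] mult.assoc mult.commute[of "F b" "Poly_Mapping.single _ _"])
      also have "\<dots> \<in> U"
      proof (intro U_add sum_mem_if_add_closed[of U] U_zero)
        show "Poly_Mapping.single w (Poly_Mapping.lookup p w) * F b \<in> U" if "w \<in> W" for w
          using that b by (intro U_term) (simp add: T_def)
        show "F (b(i := Suc (b i))) * g i \<in> U" if i: "i \<in> {1..r}" for i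
        proof (rule less.hyps)
          have "(\<Sum>j=1..r. (b(i := Suc (b i))) j) = Suc (b i) + (\<Sum>j\<in>{1..r} - {i}. b j)"
            using i by (subst sum.remove[of _ i]) auto
          moreover have "(\<Sum>j=1..r. b j) = b i + (\<Sum>j\<in>{1..r} - {i}. b j)"
            using i by (subst sum.remove[of _ i]) auto
          ultimately show "K - (\<Sum>j=1..r. (b(i := Suc (b i))) j) < K - (\<Sum>j=1..r. b j)"
            using False by simp
          show "b(i := Suc (b i)) \<in> {1..r} \<rightarrow>\<^sub>E UNIV"
            using less.prems(1) i by (auto simp: PiE_iff extensional_def)
        qed (use g i in auto)
      qed
      finally show ?thesis .
    qed
  qed
  let ?B = "box_monoms V k"
  have "Poly_Mapping.single a 1 \<in> U" if a: "a \<in> ?B" for a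
  proof -
    have "F (restrict (\<lambda>_. 0) {1..r}) = 1"
      by (simp add: F_def)
    moreover have "Poly_Mapping.single a 1 \<in> ?C"
      using a by (simp add: poly_ring_carrier_iff box_monoms_def)
    ultimately show ?thesis
      using U_F[of "restrict (\<lambda>_. 0) {1..r}" "Poly_Mapping.single a 1"] by simp
  qed
  then have "\<forall>a\<in>?B. \<exists>\<alpha>. \<forall>m. wt m < K \<longrightarrow>
      Poly_Mapping.lookup (Poly_Mapping.single a 1) m = (\<Sum>t\<in>T. \<alpha> t * Poly_Mapping.lookup (G t) m)"
    unfolding U_def by simp
  from bchoice[OF this] obtain \<alpha> where \<alpha>: "\<forall>a\<in>?B. \<forall>m. wt m < K \<longrightarrow>
      Poly_Mapping.lookup (Poly_Mapping.single a 1) m = (\<Sum>t\<in>T. \<alpha> a t * Poly_Mapping.lookup (G t) m)"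
    by blast
  have "card T = card W * (card V ^ r * k ^ r)"
    by (simp add: T_def card_cartesian_product card_PiE K_def power_mult_distrib)
  also have "\<dots> < k * k ^ r"
    by (simp add: k_def flip: mult.assoc)
  also have "\<dots> \<le> k ^ card V"
    using power_increasing[OF r, of k] by (simp add: k_def)
  finally have "card T < card ?B"
    using V by (simp add: card_box_monoms)
  \<comment> \<open>A nontrivial combination of box monomials whose coordinates with respect to
    \<open>T\<close> all vanish. Box monomials have weight below \<open>K\<close>, so its
    coefficients can be read off, and they are all 0.\<close>
  then obtain c where c: "\<exists>a\<in>?B. c a \<noteq> 0" "\<And>t. t \<in> T \<Longrightarrow> (\<Sum>a\<in>?B. c a * \<alpha> a t) = 0"
    using homogeneous_system_nontrivial[of T ?B \<alpha>] finT V by (auto simp: finite_box_monoms)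
  have "c m = 0" if m: "m \<in> ?B" for m
  proof -
    have V0: "V \<noteq> {}"
      using r by auto
    have "wt m < (\<Sum>v\<in>V. k)"
      unfolding wt_def using m V V0 by (intro sum_strict_mono) (auto simp: box_monoms_def)
    then have "wt m < K"
      by (simp add: K_def)
    have "c m = (\<Sum>a\<in>?B. c a * Poly_Mapping.lookup (Poly_Mapping.single a 1) m)"
    proof -
      have "(\<Sum>a\<in>?B. c a * Poly_Mapping.lookup (Poly_Mapping.single a 1) m) = (\<Sum>a\<in>?B. if a = m then c a else 0)"
        by (intro sum.cong) (auto simp: lookup_single)
      then show ?thesis
        using m V by (simp add: finite_box_monoms)
    qed
    also have "\<dots> = (\<Sum>a\<in>?B. \<Sum>t\<in>T. c a * \<alpha> a t * Poly_Mapping.lookup (G t) m)"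
      by (intro sum.cong) (simp_all add: \<alpha> \<open>wt m < K\<close> sum_distrib_left mult.assoc)
    also have "\<dots> = (\<Sum>t\<in>T. (\<Sum>a\<in>?B. c a * \<alpha> a t) * Poly_Mapping.lookup (G t) m)"
      by (subst sum.swap) (simp add: sum_distrib_right)
    also have "\<dots> = 0"
      by (simp add: c)
    finally show ?thesis .
  qed
  then show False
    using c(1) by blast
qed

section \<open>The radical as an intersection of primes\<close>

text \<open>By Zorn's lemma there is an ideal maximal among those that contain \<open>J\<close> and
  no power of \<open>a\<close>; such an ideal is prime.\<close>

lemma (in cring) mem_radical_if_mem_primes:
  assumes J: "ideal J R" and a: "a \<in> carrier R"
    and primes: "\<And>Q. primeideal Q R \<Longrightarrow> J \<subseteq> Q \<Longrightarrow> a \<in> Q"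
  shows "a \<in> radical R J"
proof (rule ccontr)
  assume not_rad: "a \<notin> radical R J"
  \<comment> \<open>\<open>radical\<close> asks for a positive exponent, so the exponent 0 is
    excluded by one further factor \<open>a\<close>.\<close>
  have powJ: "a [^] k \<notin> J" for k :: nat
  proof
    assume "a [^] k \<in> J"
    then have "a [^] Suc k \<in> J"
      using ideal.I_r_closed[OF J _ a] by simp
    then show False
      using not_rad a by (auto simp: radical_def)
  qed
  let ?\<A> = "{I. ideal I R \<and> J \<subseteq> I \<and> (\<forall>k::nat. a [^] k \<notin> I)}"
  have "\<exists>M\<in>?\<A>. \<forall>X\<in>?\<A>. M \<subseteq> X \<longrightarrow> X = M"
  proof (rule subset_Zorn_nonempty)
    show "?\<A> \<noteq> {}"
      using J powJ by blast
    fix C assume C: "C \<noteq> {}" "subset.chain ?\<A> C"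
    have "subset.chain {I. ideal I R} C"
      using C(2) unfolding subset.chain_def by blast
    then have "ideal (\<Union>C) R"
      using chain_Union_is_ideal[of C] C(1) by simp
    then show "\<Union>C \<in> ?\<A>"
      using C unfolding subset.chain_def by blast
  qed
  then obtain M where M: "ideal M R" "J \<subseteq> M" "\<And>k::nat. a [^] k \<notin> M"
    and max: "\<And>X. ideal X R \<Longrightarrow> M \<subseteq> X \<Longrightarrow> \<forall>k::nat. a [^] k \<notin> X \<Longrightarrow> X = M"
    by fastforce
  interpret M: ideal M R by fact
  \<comment> \<open>By maximality, adjoining \<open>x\<close> to \<open>M\<close> brings in a power
    of \<open>a\<close>. The product of two such powers, for \<open>x\<close> and \<open>y\<close>,
    lies in \<open>M\<close> as soon as \<open>x \<otimes> y\<close> does.\<close>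
  have pow_ext: "\<exists>k::nat. \<exists>m\<in>M. \<exists>r\<in>carrier R. a [^] k = m \<oplus> r \<otimes> x"
    if x: "x \<in> carrier R" "x \<notin> M" for x
  proof -
    let ?X = "M <+>\<^bsub>R\<^esub> PIdl x"
    have X: "ideal ?X R"
      by (intro add_ideals M cgenideal_ideal x)
    have "m \<oplus> r \<otimes> x \<in> ?X" if "m \<in> M" "r \<in> carrier R" for m r
      using that by (auto simp: set_add_def' cgenideal_def)
    then have "M \<subseteq> ?X" "x \<in> ?X"
      using x(1) by (metis M.Icarr l_null r_zero subsetI zero_closed,
        metis M.zero_closed l_one l_zero one_closed)
    then obtain k :: nat where "a [^] k \<in> ?X"
      using max[OF X] x(2) by blast
    then show ?thesis
      by (auto simp: set_add_def' cgenideal_def)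
  qed
  have "primeideal M R"
  proof (rule primeidealI[OF M(1) is_cring])
    show "carrier R \<noteq> M"
      using M(3)[of 0] by auto
    fix x y assume xy: "x \<in> carrier R" "y \<in> carrier R" "x \<otimes> y \<in> M"
    show "x \<in> M \<or> y \<in> M"
    proof (rule ccontr)
      assume "\<not> (x \<in> M \<or> y \<in> M)"
      then obtain k l m m' r s where k: "m \<in> M" "r \<in> carrier R" "a [^] (k::nat) = m \<oplus> r \<otimes> x"
        and l: "m' \<in> M" "s \<in> carrier R" "a [^] (l::nat) = m' \<oplus> s \<otimes> y"
        using pow_ext xy by metis
      have [simp]: "m \<in> carrier R" "m' \<in> carrier R"
        using k l by (auto intro: M.Icarr)
      have "a [^] (k + l) = (m \<oplus> r \<otimes> x) \<otimes> (m' \<oplus> s \<otimes> y)"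
        using a by (simp add: nat_pow_mult[symmetric] k(3) l(3))
      also have "\<dots> = m \<otimes> (m' \<oplus> s \<otimes> y) \<oplus> ((r \<otimes> x) \<otimes> m' \<oplus> (r \<otimes> s) \<otimes> (x \<otimes> y))"
        using k l xy by (simp add: l_distr r_distr a_ac m_ac)
      also have "\<dots> \<in> M"
        using k l xy by (intro M.a_closed M.I_r_closed[OF k(1)] M.I_l_closed[OF l(1)] M.I_l_closed[OF xy(3)]) auto
      finally show False
        using M(3) by blast
    qed
  qed
  then show False
    using primes[of M] M(2) M(3)[of 1] a by auto
qed

lemma (in primeideal) radical_subset:
  assumes "J \<subseteq> I"
  shows "radical R J \<subseteq> I"
proof
  fix a assume "a \<in> radical R J"
  then obtain k :: nat where a: "a \<in> carrier R" "a [^] k \<in> I"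
    using assms by (auto simp: radical_def)
  then show "a \<in> I"
  proof (induction k)
    case 0
    then show ?case
      using one_imp_carrier I_notcarr by simp
  next
    case (Suc k)
    then show ?case
      using I_prime[of "a [^] k" a] by auto
  qed
qed

text \<open>Each radical is the intersection of the primes above the ideal, so two radicals can be
  compared without exhibiting exponents.\<close>

lemma (in cring) radical_eqI:
  assumes "ideal I R" "ideal J R"
    and "\<And>Q. primeideal Q R \<Longrightarrow> I \<subseteq> Q \<longleftrightarrow> J \<subseteq> Q"
  shows "radical R I = radical R J"
proof -
  have "radical R A \<subseteq> radical R B"
    if "ideal B R" "\<And>Q. primeideal Q R \<Longrightarrow> A \<subseteq> Q \<longleftrightarrow> B \<subseteq> Q" for A B
  proof
    fix a assume a: "a \<in> radical R A"
    show "a \<in> radical R B"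
    proof (rule mem_radical_if_mem_primes[OF that(1)])
      show "a \<in> Q" if "primeideal Q R" "B \<subseteq> Q" for Q
        using primeideal.radical_subset[of Q R A] that a
          \<open>\<And>Q. primeideal Q R \<Longrightarrow> A \<subseteq> Q \<longleftrightarrow> B \<subseteq> Q\<close> by blast
    qed (use a in \<open>simp add: radical_def\<close>)
  qed
  then show ?thesis
    using assms by (metis subset_antisym)
qed

lemma (in ring) Idl_subset_iff:
  assumes "S \<subseteq> carrier R" "ideal I R"
  shows "Idl S \<subseteq> I \<longleftrightarrow> S \<subseteq> I"
  using genideal_self[OF assms(1)] genideal_minimal[OF assms(2)] by auto

section \<open>Primes containing the path binomials\<close>

text \<open>The equation x_{j+1} = x_1 t^j with t = x_2/x_1, multiplied by x_1^j. It is trivial for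
  j = 0 and j = 1.\<close>

abbreviation curve_congruence :: "((nat \<Rightarrow>\<^sub>0 nat) \<Rightarrow>\<^sub>0 'k::comm_ring_1) set \<Rightarrow> nat \<Rightarrow> bool"
  where "curve_congruence Q j \<equiv> var 1 ^ j * var (Suc j) - var 1 * var 2 ^ j \<in> Q"

text \<open>The parametrization \<open>x\<^sub>i \<mapsto> s t\<^bsup>i-1\<^esup>\<close> of the first \<open>k\<close> variables, where \<open>s = x\<^sub>1\<close> and \<open>t\<close> is the
  variable \<open>x\<^sub>0\<close>, which does not occur in the Hankel ring.\<close>

definition curve_subst :: "nat \<Rightarrow> nat \<Rightarrow> nat \<Rightarrow> (nat \<Rightarrow>\<^sub>0 nat) \<Rightarrow>\<^sub>0 'k::comm_ring_1"
  where "curve_subst n k i =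
    (if i = 0 \<or> n + 1 < i then 0 else if i \<le> k then var 1 * var 0 ^ (i - 1) else var i)"

lemma (in prime_subset) cancel_mem: "c * (a - b) \<in> Q \<Longrightarrow> c \<notin> Q \<Longrightarrow> a - b \<in> Q"
  using prime_mem by blast

context
  fixes Q :: "((nat \<Rightarrow>\<^sub>0 nat) \<Rightarrow>\<^sub>0 'k::comm_ring_1) set"
  assumes prime: "prime_subset Q"
begin

interpretation prime_subset Q by (rule prime)

text \<open>Since x_{j+1}^2 = x_j x_{j+2} - g_{j,j+1}, membership passes from x_j to x_{j+1}. It
  stops at x_n, because the last path binomial is g_{n-1,n}.\<close>

lemma path_var_mem:
  assumes path: "\<And>i. 1 \<le> i \<Longrightarrow> i < n \<Longrightarrow> hankel_binomial i (i + 1) \<in> Q"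
    and "var i \<in> Q" "1 \<le> i" "i \<le> j" "j \<le> n"
  shows "var j \<in> Q"
  using assms(4,5)
proof (induction j rule: dec_induct)
  case (step j)
  have "var j * var (j + 2) - hankel_binomial j (j + 1) \<in> Q"
    using step path[of j] \<open>1 \<le> i\<close> by (intro diff_mem mult_mem_right) auto
  then have "var (Suc j) * var (Suc j) \<in> Q"
    by (simp add: hankel_binomial_def)
  then show ?case
    using prime_mem by blast
qed (use assms in auto)

text \<open>If some x_i with 2 <= i <= n is outside \<open>Q\<close>, then by propagation so are x_1
  and x_2, and both can be cancelled. The binomial g_{j-1,j} then determines x_{j+1} from its two
  predecessors.\<close>

lemma path_primes:
  assumes path: "\<And>i. 1 \<le> i \<Longrightarrow> i < n \<Longrightarrow> hankel_binomial i (i + 1) \<in> Q"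
  shows "(\<forall>i\<in>{2..n}. var i \<in> Q) \<or> (var 1 \<notin> Q \<and> (\<forall>j\<le>n. curve_congruence Q j))"
proof (cases "\<forall>i\<in>{2..n}. var i \<in> Q")
  case False
  then obtain i where i: "2 \<le> i" "i \<le> n" "var i \<notin> Q"
    by auto
  have x1: "var 1 \<notin> Q" and x2: "var 2 \<notin> Q"
    using path_var_mem[OF path, of n 1 i] path_var_mem[OF path, of n 2 i] i by auto
  have "curve_congruence Q j" if "j \<le> n" for j
    using that
  proof (induction j rule: less_induct)
    case (less j)
    consider "j = 0" | "j = 1" | j' where "j = Suc (Suc j')"
      by (metis One_nat_def not0_implies_Suc)
    then show ?case
    proof cases
      case 3
      let ?a = "var (Suc j') :: (nat \<Rightarrow>\<^sub>0 nat) \<Rightarrow>\<^sub>0 'k" and ?b = "var (Suc (Suc j')) :: (nat \<Rightarrow>\<^sub>0 nat) \<Rightarrow>\<^sub>0 'k"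
        and ?c = "var (Suc (Suc (Suc j'))) :: (nat \<Rightarrow>\<^sub>0 nat) \<Rightarrow>\<^sub>0 'k"
        and ?x = "var 1 :: (nat \<Rightarrow>\<^sub>0 nat) \<Rightarrow>\<^sub>0 'k" and ?y = "var 2 :: (nat \<Rightarrow>\<^sub>0 nat) \<Rightarrow>\<^sub>0 'k"
      have IH: "?x ^ j' * ?a - ?x * ?y ^ j' \<in> Q" "?x ^ Suc j' * ?b - ?x * ?y ^ Suc j' \<in> Q"
        using less.IH[of j'] less.IH[of "Suc j'"] less.prems 3 by auto
      have "?a * ?c - ?b * ?b \<in> Q"
        using path[of "Suc j'"] less.prems 3 by (simp add: hankel_binomial_def)
      \<comment> \<open>This power of x_1 supplies exactly the factors that the congruences for j',
        j' + 1 and j' + 2 attach to \<open>?a\<close>, \<open>?b\<close> and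
        \<open>?c\<close>.\<close>
      then have "(?x ^ j' * ?x ^ j' * ?x * ?x) * (?a * ?c - ?b * ?b) \<in> Q"
        by (rule mult_mem)
      then have 1: "(?x ^ j' * ?a) * (?x ^ (j' + 2) * ?c) - (?x ^ Suc j' * ?b) * (?x ^ Suc j' * ?b) \<in> Q"
        by (simp add: algebra_simps power_add)
      have 2: "(?x ^ Suc j' * ?b) * (?x ^ Suc j' * ?b) - (?x * ?y ^ Suc j') * (?x * ?y ^ Suc j') \<in> Q"
        by (intro diff_mult IH)
      have 3: "(?x * ?y ^ j') * (?x ^ (j' + 2) * ?c) - (?x ^ j' * ?a) * (?x ^ (j' + 2) * ?c) \<in> Q"
        using mult_mem[OF IH(1), of "- (?x ^ (j' + 2) * ?c)"] by (simp add: algebra_simps)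
      have "(?x * ?y ^ j') * (?x ^ (j' + 2) * ?c) - (?x * ?y ^ Suc j') * (?x * ?y ^ Suc j') \<in> Q"
        by (rule diff_trans[OF 3 diff_trans[OF 1 2]])
      then have "(?x * ?y ^ j') * (?x ^ (j' + 2) * ?c - ?x * ?y ^ (j' + 2)) \<in> Q"
        by (simp add: algebra_simps)
      moreover have "?x * ?y ^ j' \<notin> Q"
        using x1 x2 prime_mem power_memD by blast
      ultimately show ?thesis
        using cancel_mem \<open>j = Suc (Suc j')\<close> by fastforce
    qed (simp_all add: zero_mem numeral_2_eq_2)
  qed
  then show ?thesis
    using x1 by blast
qed simp

text \<open>Write i = a + 1 and j = b + 1. After multiplication by x_1^(a+b+1), both products in the
  binomial are congruent to x_1^2 x_2^(a+b+1).\<close>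

lemma hankel_binomial_mem_of_curve:
  assumes x1: "var 1 \<notin> Q" and curve: "\<And>j. j \<le> n \<Longrightarrow> curve_congruence Q j"
    and "1 \<le> i" "i \<le> n" "1 \<le> j" "j \<le> n"
  shows "hankel_binomial i j \<in> Q"
proof -
  obtain a b where ab: "i = Suc a" "j = Suc b"
    using assms by (metis Suc_le_D One_nat_def)
  let ?x = "var 1 :: (nat \<Rightarrow>\<^sub>0 nat) \<Rightarrow>\<^sub>0 'k" and ?y = "var 2 :: (nat \<Rightarrow>\<^sub>0 nat) \<Rightarrow>\<^sub>0 'k"
  have 1: "(?x ^ a * var (Suc a)) * (?x ^ Suc b * var (Suc (Suc b))) - (?x * ?y ^ a) * (?x * ?y ^ Suc b) \<in> Q"
    by (intro diff_mult curve) (use assms ab in auto)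
  have 2: "(?x ^ b * var (Suc b)) * (?x ^ Suc a * var (Suc (Suc a))) - (?x * ?y ^ b) * (?x * ?y ^ Suc a) \<in> Q"
    by (intro diff_mult curve) (use assms ab in auto)
  have "?x ^ (a + b + 1) * hankel_binomial i j \<in> Q"
    using diff_mem[OF 1 2] by (simp add: hankel_binomial_def ab algebra_simps power_add)
  then show ?thesis
    using x1 prime_mem power_memD by blast
qed

end

section \<open>The prime of the cone over the rational normal curve and two primes above it\<close>

lemma var_nonzero [simp]: "var i \<noteq> (0 :: ('v \<Rightarrow>\<^sub>0 nat) \<Rightarrow>\<^sub>0 'k::comm_ring_1)"
  by (metis keys_single keys_zero insert_not_empty var_def zero_neq_one)

lemma curve_congruence_kernel:
  assumes "n \<ge> 1" "k \<ge> 2" "j \<le> n" "j < k"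
  shows "curve_congruence {p. subst (curve_subst n k) p = (0 :: (nat \<Rightarrow>\<^sub>0 nat) \<Rightarrow>\<^sub>0 'k::idom)} j"
  using assms by (simp add: subst_simps curve_subst_def algebra_simps power_mult_distrib)

text \<open>The chain from the cone through the x_1-axis to the origin serves twice: it proves x_1
  and x_2 independent on the cone, and it bounds the height of the cone's prime from above.\<close>

definition origin_ideal :: "((nat \<Rightarrow>\<^sub>0 nat) \<Rightarrow>\<^sub>0 'k::idom) set"
  where "origin_ideal = {p. subst (\<lambda>_. 0 :: (nat \<Rightarrow>\<^sub>0 nat) \<Rightarrow>\<^sub>0 'k) p = 0}"

definition axis_ideal :: "((nat \<Rightarrow>\<^sub>0 nat) \<Rightarrow>\<^sub>0 'k::idom) set"
  where "axis_ideal = {p. subst (\<lambda>i. if i = 1 then var 1 else 0 :: (nat \<Rightarrow>\<^sub>0 nat) \<Rightarrow>\<^sub>0 'k) p = 0}"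

text \<open>Variables outside 1, ..., n + 1 go to 0, just as under \<open>lift_ideal\<close>, so
  that the two kinds of ideals can be compared on the whole type.\<close>

definition curve_ideal :: "nat \<Rightarrow> ((nat \<Rightarrow>\<^sub>0 nat) \<Rightarrow>\<^sub>0 'k::idom) set"
  where "curve_ideal n = {p. subst (curve_subst n (n + 1)) p = (0 :: (nat \<Rightarrow>\<^sub>0 nat) \<Rightarrow>\<^sub>0 'k)}"

lemma prime_subset_origin_ideal: "prime_subset origin_ideal"
  and prime_subset_axis_ideal: "prime_subset axis_ideal"
  and prime_subset_curve_ideal: "prime_subset (curve_ideal n)"
  unfolding origin_ideal_def axis_ideal_def curve_ideal_def by (rule prime_subset_kernel)+

text \<open>\<open>subst \<rho>\<close> factors through \<open>subst \<sigma>\<close>. Every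
  inclusion between kernels below is such a specialization.\<close>

lemma kernel_subset:
  assumes "\<And>i. \<rho> i = subst \<theta> (\<sigma> i)"
  shows "{p. subst \<sigma> p = 0} \<subseteq> {p. subst \<rho> p = 0}"
proof -
  have "\<rho> = (\<lambda>i. subst \<theta> (\<sigma> i))"
    using assms by blast
  then show ?thesis
    by (auto simp flip: subst_subst)
qed

lemma axis_subset_origin: "axis_ideal \<subseteq> origin_ideal"
  unfolding axis_ideal_def origin_ideal_def
  by (rule kernel_subset[of _ "\<lambda>_. 0"]) simp

lemma curve_subset_axis: "n \<ge> 1 \<Longrightarrow> curve_ideal n \<subseteq> axis_ideal"
  unfolding axis_ideal_def curve_ideal_def
  by (rule kernel_subset[of _ "\<lambda>i. if i = 1 then var 1 else 0"])
    (auto simp: curve_subst_def subst_simps)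

lemma var_mem_ideals:
  "var 1 \<in> origin_ideal" "var 1 \<notin> axis_ideal" "var 2 \<in> axis_ideal" "n \<ge> 1 \<Longrightarrow> var 2 \<notin> curve_ideal n"
  by (auto simp: origin_ideal_def axis_ideal_def curve_ideal_def curve_subst_def)

text \<open>Each descent from origin to axis to cone adds one independent element: x_1 vanishes at
  the origin but not on the axis, x_2 on the axis but not on the cone.\<close>

lemma alg_indep_mod_curve:
  assumes "n \<ge> 1"
  shows "alg_indep_mod (curve_ideal n :: ((nat \<Rightarrow>\<^sub>0 nat) \<Rightarrow>\<^sub>0 'k::field) set) 2 (\<lambda>i. var (Suc i))"
proof -
  have "alg_indep_mod (axis_ideal :: ((nat \<Rightarrow>\<^sub>0 nat) \<Rightarrow>\<^sub>0 'k) set) (Suc 0) ((\<lambda>i. var (Suc i))(0 := var 1))"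
    by (rule alg_indep_mod_extend[OF prime_subset_origin_ideal prime_subset_axis_ideal axis_subset_origin])
      (rule var_mem_ideals alg_indep_mod_0 prime_subset_origin_ideal)+
  then have "alg_indep_mod (curve_ideal n :: ((nat \<Rightarrow>\<^sub>0 nat) \<Rightarrow>\<^sub>0 'k) set) (Suc (Suc 0))
      (((\<lambda>i. var (Suc i))(0 := var 1))(Suc 0 := var 2))"
    using assms
    by (intro alg_indep_mod_extend[OF prime_subset_axis_ideal prime_subset_curve_ideal curve_subset_axis]
        var_mem_ideals)
  moreover have "((\<lambda>i. var (Suc i))(0 := var 1))(Suc 0 := var 2) = (\<lambda>i. var (Suc i) :: (nat \<Rightarrow>\<^sub>0 nat) \<Rightarrow>\<^sub>0 'k)"
    by (auto simp: numeral_2_eq_2)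
  ultimately show ?thesis
    by (simp only: numeral_2_eq_2)
qed

text \<open>Modulo both ideals, every polynomial times a power of \<open>x\<^sub>1\<close> is congruent to the same polynomial in
  \<open>x\<^sub>1, x\<^sub>2\<close>, and these are algebraically independent modulo the ideal of the curve.\<close>

lemma curve_ideal_subset:
  fixes Q :: "((nat \<Rightarrow>\<^sub>0 nat) \<Rightarrow>\<^sub>0 'k::field) set"
  assumes "prime_subset Q" "n \<ge> 1" and x1: "var 1 \<notin> Q"
    and curve: "\<And>j. j \<le> n \<Longrightarrow> curve_congruence Q j"
    and out: "\<And>i. i \<notin> {1..n + 1} \<Longrightarrow> var i \<in> Q"
  shows "curve_ideal n \<subseteq> Q"
proof
  interpret Q: prime_subset Q by fact
  interpret P: prime_subset "curve_ideal n :: ((nat \<Rightarrow>\<^sub>0 nat) \<Rightarrow>\<^sub>0 'k) set"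
    by (rule prime_subset_curve_ideal)
  let ?P = "curve_ideal n :: ((nat \<Rightarrow>\<^sub>0 nat) \<Rightarrow>\<^sub>0 'k) set"
  let ?S = "subst (\<lambda>i. var (Suc i)) :: ((nat \<Rightarrow>\<^sub>0 nat) \<Rightarrow>\<^sub>0 'k) \<Rightarrow> _"
  \<comment> \<open>The variables 0 and 1 of \<open>q\<close> stand for x_1 and x_2. One pair
    \<open>N\<close>, \<open>q\<close> must serve both ideals, since \<open>q\<close> carries the
    information from one to the other.\<close>
  define approx where "approx = (\<lambda>N p q. q \<in> carrier (poly_ring {..<2}) \<and>
    var 1 ^ N * p - ?S q \<in> ?P \<and> var 1 ^ N * p - ?S q \<in> Q)"
  have "\<exists>N q. approx N p q" for p
  proof (induction p rule: mpoly_induct)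
    case (const c)
    have "approx 0 (Poly_Mapping.single 0 c) (Poly_Mapping.single 0 c)"
      by (simp add: approx_def poly_ring_const P.zero_mem Q.zero_mem)
    then show ?case
      by blast
  next
    case (var i)
    show ?case
    proof (cases "i \<in> {1..n + 1}")
      case True
      then obtain j where j: "i = Suc j" "j \<le> n"
        by (metis Suc_eq_plus1 Suc_le_D Suc_le_mono atLeastAtMost_iff One_nat_def)
      have "curve_congruence ?P j"
        unfolding curve_ideal_def using assms(2) j by (intro curve_congruence_kernel) auto
      \<comment> \<open>The witness is read off from x_1^j x_{j+1} = x_1 x_2^j, valid modulo both
        ideals.\<close>
      then have "approx j (var i) (var 0 * var 1 ^ j)"
        using curve[OF j(2)] j
        by (simp add: approx_def subst_simps poly_ring_closed numeral_2_eq_2)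
      then show ?thesis
        by blast
    next
      case False
      then have "var i \<in> ?P"
        by (auto simp: curve_ideal_def curve_subst_def)
      then have "approx 0 (var i) 0"
        using out[OF False] by (simp add: approx_def poly_ring_zero)
      then show ?thesis
        by blast
    qed
  next
    case (add p p')
    then obtain N M q q' where a: "approx N p q" "approx M p' q'"
      by blast
    have eq: "var 1 ^ (N + M) * (p + p') - ?S (var 0 ^ M * q + var 0 ^ N * q') =
        var 1 ^ M * (var 1 ^ N * p - ?S q) + var 1 ^ N * (var 1 ^ M * p' - ?S q')"
      by (simp add: subst_simps algebra_simps power_add)
    have "approx (N + M) (p + p') (var 0 ^ M * q + var 0 ^ N * q')"
      using a unfolding approx_def eq
      by (auto intro!: poly_ring_closed P.add_mem P.mult_mem Q.add_mem Q.mult_mem)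
    then show ?case
      by blast
  next
    case (mult p p')
    then obtain N M q q' where a: "approx N p q" "approx M p' q'"
      by blast
    have eq: "var 1 ^ (N + M) * (p * p') - ?S (q * q') =
        (var 1 ^ N * p) * (var 1 ^ M * p') - ?S q * ?S q'"
      by (simp add: subst_simps algebra_simps power_add)
    have "approx (N + M) (p * p') (q * q')"
      using a unfolding approx_def eq by (auto intro!: poly_ring_closed P.diff_mult Q.diff_mult)
    then show ?case
      by blast
  qed
  note approx_exists = this
  fix p assume p: "p \<in> ?P"
  obtain N q where a: "approx N p q"
    using approx_exists by blast
  have "?S q \<in> ?P"
    using a p P.mem_cong P.mult_mem unfolding approx_def by blast
  then have "q = 0"
    using a alg_indep_mod_curve[OF assms(2)] unfolding approx_def alg_indep_mod_def by blast
  then have "var 1 ^ N * p \<in> Q"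
    using a by (simp add: approx_def)
  then show "p \<in> Q"
    using x1 Q.prime_mem Q.power_memD by blast
qed

section \<open>Heights\<close>

text \<open>Replacing the top of the chain by the larger \<open>P\<close> keeps all inclusions
  strict.\<close>

lemma prime_height_ge:
  assumes "prime_chain R c h" "c h \<subseteq> P" "primeideal P R"
  shows "enat h \<le> prime_height R P"
proof -
  have "prime_chain R (c(h := P)) h"
    using assms unfolding prime_chain_def by (auto simp: less_Suc_eq_le intro: psubset_subset_trans)
  then show ?thesis
    unfolding prime_height_def by (intro Sup_upper) (auto intro: exI[of _ "c(h := P)"])
qed

text \<open>Intersecting with the carrier could identify two kernels, so each strict inclusion asks
  for a witness in the carrier.\<close>

lemma prime_chain_kernels:
  fixes K :: "nat \<Rightarrow> (('v \<Rightarrow>\<^sub>0 nat) \<Rightarrow>\<^sub>0 'k::comm_ring_1) set"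
  assumes "\<And>j. j \<le> h \<Longrightarrow> prime_subset (K j)" "\<And>j. j < h \<Longrightarrow> K j \<subseteq> K (Suc j)"
    and "\<And>j. j < h \<Longrightarrow> \<exists>p\<in>carrier (poly_ring V). p \<in> K (Suc j) \<and> p \<notin> K j"
  shows "prime_chain (poly_ring V) (\<lambda>j. K j \<inter> carrier (poly_ring V)) h"
  unfolding prime_chain_def
proof (intro conjI allI impI)
  show "primeideal (K j \<inter> carrier (poly_ring V)) (poly_ring V)" if "j \<le> h" for j
    by (rule primeideal_Int_carrier[OF assms(1)[OF that]])
  show "K j \<inter> carrier (poly_ring V) \<subset> K (Suc j) \<inter> carrier (poly_ring V)" if "j < h" for j
    using assms(2)[OF that] assms(3)[OF that] by blast
qed

text \<open>The chain is 0 < (x_2) < (x_2, x_3) < ... < (x_2, ..., x_n), each ideal realized as the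
  kernel of setting its generators to 0.\<close>

lemma prime_height_ge_of_coordinates:
  fixes Q :: "((nat \<Rightarrow>\<^sub>0 nat) \<Rightarrow>\<^sub>0 'k::field) set"
  assumes Q: "primeideal Q (hankel_ring n)" and vars: "\<forall>i\<in>{2..n}. var i \<in> Q"
  shows "enat (n - 1) \<le> prime_height (hankel_ring n) Q"
proof -
  let ?\<sigma> = "\<lambda>j i. if 2 \<le> i \<and> i \<le> j + 1 then 0 else var i :: (nat \<Rightarrow>\<^sub>0 nat) \<Rightarrow>\<^sub>0 'k"
  let ?K = "\<lambda>j. {p. subst (?\<sigma> j) p = 0}"
  let ?Q = "lift_ideal {1..n + 1} Q"
  have "prime_chain (hankel_ring n) (\<lambda>j. ?K j \<inter> carrier (hankel_ring n)) (n - 1)"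
  proof (rule prime_chain_kernels)
    show "?K j \<subseteq> ?K (Suc j)" for j
      by (rule kernel_subset[of _ "?\<sigma> (Suc j)"]) auto
    show "\<exists>p\<in>carrier (hankel_ring n). p \<in> ?K (Suc j) \<and> p \<notin> ?K j" if "j < n - 1" for j
      using that by (intro bexI[of _ "var (j + 2)"]) (auto simp: var_in_carrier)
  qed (rule prime_subset_kernel)
  moreover have "?K (n - 1) \<inter> carrier (hankel_ring n) \<subseteq> Q"
  proof
    fix p assume p: "p \<in> ?K (n - 1) \<inter> carrier (hankel_ring n)"
    have prime: "prime_subset ?Q"
      by (rule prime_subset_lift_ideal[OF Q])
    \<comment> \<open>Only variables that lie in \<open>?Q\<close> are changed, so \<open>p\<close>
      is congruent to its image, which is 0.\<close>
    have "subst var p - subst (?\<sigma> (n - 1)) p \<in> ?Q"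
    proof (rule prime_subset_diff_subst[OF prime])
      show "var i - ?\<sigma> (n - 1) i \<in> ?Q" for i
      proof (cases "2 \<le> i \<and> i \<le> n - 1 + 1")
        case True
        then have i: "i \<in> {2..n}" "i \<in> {1..n + 1}"
          by auto
        then have "var i \<in> ?Q"
          using vars by (simp only: mem_lift_ideal_iff[OF var_in_carrier[OF i(2)]])
        then show ?thesis
          using True by simp
      next
        case False
        then show ?thesis
          using prime_subset.zero_mem[OF prime] by (simp only: if_False diff_self)
      qed
    qed
    then show "p \<in> Q"
      using p by (simp add: mem_lift_ideal_iff)
  qed
  ultimately show ?thesis
    using Q by (rule prime_height_ge)
qed

text \<open>The variables are put on the curve one after another: the j-th substitution parametrizes
  the first j + 2 of them and leaves the rest free. It takes n - 1 steps until all n + 1 are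
  parametrized.\<close>

lemma prime_height_ge_of_curve:
  fixes Q :: "((nat \<Rightarrow>\<^sub>0 nat) \<Rightarrow>\<^sub>0 'k::field) set"
  assumes Q: "primeideal Q (hankel_ring n)" and n: "n \<ge> 1"
    and sub: "curve_ideal n \<inter> carrier (hankel_ring n) \<subseteq> Q"
  shows "enat (n - 1) \<le> prime_height (hankel_ring n) Q"
proof -
  let ?\<sigma> = "\<lambda>j. curve_subst n (j + 2) :: nat \<Rightarrow> (nat \<Rightarrow>\<^sub>0 nat) \<Rightarrow>\<^sub>0 'k"
  let ?K = "\<lambda>j. {p. subst (?\<sigma> j) p = 0}"
  have "prime_chain (hankel_ring n) (\<lambda>j. ?K j \<inter> carrier (hankel_ring n)) (n - 1)"
  proof (rule prime_chain_kernels)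
    show "?K j \<subseteq> ?K (Suc j)" for j
      by (rule kernel_subset[of _ "\<lambda>i. if i = j + 3 then var 1 * var 0 ^ (j + 2) else var i"])
        (auto simp: curve_subst_def subst_simps le_Suc_eq)
    show "\<exists>p\<in>carrier (hankel_ring n). p \<in> ?K (Suc j) \<and> p \<notin> ?K j" if j: "j < n - 1" for j
    proof (intro bexI conjI)
      \<comment> \<open>x_{j+3} is free in step j and parametrized in step j + 1, so x_{j+1} x_{j+3}
        - x_{j+2}^2 is sent to 0 only by the latter.\<close>
      let ?g = "hankel_binomial (j + 1) (j + 2) :: (nat \<Rightarrow>\<^sub>0 nat) \<Rightarrow>\<^sub>0 'k"
      show "?g \<in> carrier (hankel_ring n)"
        unfolding hankel_binomial_def using j by (intro poly_ring_closed) auto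
      have j': "\<not> n < Suc (Suc j)" "\<not> n < Suc j" "\<not> n < j"
        using j by auto
      show "?g \<in> ?K (Suc j)"
        using j' by (simp add: hankel_binomial_def subst_simps curve_subst_def algebra_simps)
      \<comment> \<open>At s = t = 1, with the free variables set to 0, the image of
        \<open>?g\<close> becomes -1.\<close>
      have "subst (\<lambda>i. if i \<le> 1 then 1 else 0) (subst (?\<sigma> j) ?g) \<noteq> (0 :: (nat \<Rightarrow>\<^sub>0 nat) \<Rightarrow>\<^sub>0 'k)"
        using j' by (simp add: hankel_binomial_def subst_simps curve_subst_def)
      then show "?g \<notin> ?K j"
        by auto
    qed
  qed (rule prime_subset_kernel)
  moreover have "?K (n - 1) = curve_ideal n"
    using n by (simp add: curve_ideal_def)
  ultimately show ?thesis
    using sub prime_height_ge[OF _ _ Q] by metis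
qed

text \<open>Every chain that ends at the cone extends by the axis and the origin, while chains in n
  + 1 variables have length at most n + 1.\<close>

lemma prime_height_curve_le:
  assumes n: "n \<ge> 1"
  shows "prime_height (hankel_ring n) (curve_ideal n \<inter> carrier (hankel_ring n)
    :: ((nat \<Rightarrow>\<^sub>0 nat) \<Rightarrow>\<^sub>0 'k::field) set) \<le> enat (n - 1)"
  unfolding prime_height_def
proof (rule Sup_least, clarify)
  let ?C = "carrier (hankel_ring n) :: ((nat \<Rightarrow>\<^sub>0 nat) \<Rightarrow>\<^sub>0 'k) set"
  let ?V = "{1..n + 1}"
  fix c h assume c: "prime_chain (hankel_ring n) c h" "c h = curve_ideal n \<inter> ?C"
  let ?c = "c(Suc h := axis_ideal \<inter> ?C, Suc (Suc h) := origin_ideal \<inter> ?C)"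
  have "curve_ideal n \<inter> ?C \<subset> axis_ideal \<inter> ?C"
  proof (rule psubsetI)
    have "var 2 \<in> axis_ideal \<inter> ?C" "var 2 \<notin> curve_ideal n \<inter> ?C"
      using n by (auto simp: var_mem_ideals var_in_carrier)
    then show "curve_ideal n \<inter> ?C \<noteq> axis_ideal \<inter> ?C"
      by blast
  qed (use curve_subset_axis[OF n] in blast)
  moreover have "axis_ideal \<inter> ?C \<subset> origin_ideal \<inter> ?C"
  proof (rule psubsetI)
    have "var 1 \<in> origin_ideal \<inter> ?C" "var 1 \<notin> axis_ideal \<inter> ?C"
      by (simp_all only: Int_iff var_mem_ideals) (simp_all add: var_in_carrier)
    then show "axis_ideal \<inter> ?C \<noteq> origin_ideal \<inter> ?C"
      by blast
  qed (use axis_subset_origin in blast)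
  ultimately have "prime_chain (hankel_ring n) ?c (Suc (Suc h))"
    using c unfolding prime_chain_def
    by (auto simp: less_Suc_eq le_Suc_eq intro!: primeideal_Int_carrier prime_subset_axis_ideal prime_subset_origin_ideal)
  then have "Suc (Suc h) \<le> card ?V"
    by (intro prime_chain_length_le) auto
  then show "enat h \<le> enat (n - 1)"
    by simp
qed

section \<open>Equations of the rational normal curve\<close>

text \<open>The equations of Robbiano and Valla, valid in every characteristic: if \<open>x\<^sub>1 = 1\<close> and
  \<open>x\<^bsub>a+1\<^esub> = t\<^sup>a\<close> for \<open>a \<le> i\<close>, the \<open>i\<close>-th one reads \<open>(x\<^bsub>i+2\<^esub> - t\<^bsup>i+1\<^esup>)\<^sup>i = 0\<close>.\<close>

definition curve_equation :: "nat \<Rightarrow> (nat \<Rightarrow>\<^sub>0 nat) \<Rightarrow>\<^sub>0 'k::comm_ring_1"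
  where "curve_equation i =
    (\<Sum>a\<le>i. (- 1) ^ a * of_nat (i choose a) * var (i + 2) ^ (i - a) * var (i + 1) ^ a * var (a + 1))"

text \<open>Replace x_1^i x_{i+1} by x_1 x_2^i and x_1^a x_{a+1} by x_1 x_2^a. With B = x_1
  x_2^(i+1) one has (x_1 x_2^i)^a x_1 x_2^a = x_1 B^a, so the sum becomes a binomial
  expansion.\<close>

lemma curve_equation_congruence:
  fixes Q :: "((nat \<Rightarrow>\<^sub>0 nat) \<Rightarrow>\<^sub>0 'k::comm_ring_1) set"
  assumes "prime_subset Q" and curve: "\<And>a. a \<le> i \<Longrightarrow> curve_congruence Q a"
  shows "var 1 ^ (i * i + i) * curve_equation i
    - var 1 * (var 1 ^ (i + 1) * var (i + 2) - var 1 * var 2 ^ (i + 1)) ^ i \<in> Q"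
proof -
  interpret prime_subset Q by fact
  let ?x = "var 1 :: (nat \<Rightarrow>\<^sub>0 nat) \<Rightarrow>\<^sub>0 'k" and ?y = "var 2 :: (nat \<Rightarrow>\<^sub>0 nat) \<Rightarrow>\<^sub>0 'k"
  let ?A = "?x ^ (i + 1) * var (i + 2)" and ?B = "?x * ?y ^ (i + 1)"
  define c :: "nat \<Rightarrow> (nat \<Rightarrow>\<^sub>0 nat) \<Rightarrow>\<^sub>0 'k" where "c a = (- 1) ^ a * of_nat (i choose a)" for a
  have "(?A - ?B) ^ i = (\<Sum>a\<le>i. of_nat (i choose a) * (- ?B) ^ a * ?A ^ (i - a))"
    using binomial_ring[of "- ?B" ?A i] by simp
  also have "\<dots> = (\<Sum>a\<le>i. c a * ?B ^ a * ?A ^ (i - a))"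
    by (intro sum.cong refl, subst power_minus) (simp only: c_def ac_simps)
  finally have rhs: "?x * (?A - ?B) ^ i = (\<Sum>a\<le>i. c a * ?A ^ (i - a) * ((?x * ?y ^ i) ^ a * (?x * ?y ^ a)))"
    by (simp add: sum_distrib_left power_mult_distrib power_add ac_simps flip: power_mult)
  have "?x ^ (i * i + i) * (c a * var (i + 2) ^ (i - a) * var (i + 1) ^ a * var (a + 1)) =
      c a * ?A ^ (i - a) * ((?x ^ i * var (Suc i)) ^ a * (?x ^ a * var (Suc a)))" if a: "a \<le> i" for a
  proof -
    obtain d where d: "i = a + d"
      using a le_Suc_ex by blast
    \<comment> \<open>The a-th term uses (i+1)(i-a) + ia + a factors x_1, which is i^2 + i for every
      a.\<close>
    have "?x ^ ((i + 1) * d + i * a + a) = ?x ^ (i * i + i)"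
      by (rule arg_cong[of _ _ "\<lambda>e. ?x ^ e"]) (simp add: d algebra_simps)
    then have "?x ^ (i * i + i) = (?x ^ (i + 1)) ^ d * (?x ^ i) ^ a * ?x ^ a"
      by (simp only: power_add power_mult)
    then show ?thesis
      by (simp add: d power_mult_distrib ac_simps)
  qed
  then have lhs: "?x ^ (i * i + i) * curve_equation i =
      (\<Sum>a\<le>i. c a * ?A ^ (i - a) * ((?x ^ i * var (Suc i)) ^ a * (?x ^ a * var (Suc a))))"
    unfolding curve_equation_def sum_distrib_left c_def by (intro sum.cong refl) simp
  show ?thesis
    unfolding lhs rhs
  proof (intro diff_sum)
    fix a assume "a \<in> {..i}"
    then have "(?x ^ i * var (Suc i)) ^ a * (?x ^ a * var (Suc a)) - (?x * ?y ^ i) ^ a * (?x * ?y ^ a) \<in> Q"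
      by (intro diff_mult diff_power curve) auto
    from mult_mem[OF this, of "c a * ?A ^ (i - a)"]
    show "c a * ?A ^ (i - a) * ((?x ^ i * var (Suc i)) ^ a * (?x ^ a * var (Suc a)))
        - c a * ?A ^ (i - a) * ((?x * ?y ^ i) ^ a * (?x * ?y ^ a)) \<in> Q"
      by (simp add: right_diff_distrib)
  qed
qed

context
  fixes Q :: "((nat \<Rightarrow>\<^sub>0 nat) \<Rightarrow>\<^sub>0 'k::comm_ring_1) set"
  assumes prime: "prime_subset Q"
begin

interpretation prime_subset Q by (rule prime)

text \<open>Given the congruences up to i, the i-th equation reduces to x_1 D^i, where D is the left
  side of the next congruence. A prime without x_1 then contains D, as i is at least 1.\<close>

lemma curve_of_equations:
  assumes x1: "var 1 \<notin> Q" and eqs: "\<And>i. 1 \<le> i \<Longrightarrow> i < n \<Longrightarrow> curve_equation i \<in> Q" and "j \<le> n"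
  shows "curve_congruence Q j"
  using \<open>j \<le> n\<close>
proof (induction j rule: less_induct)
  case (less j)
  consider "j = 0" | "j = 1" | i where "j = Suc i" "1 \<le> i"
    by (metis One_nat_def Suc_le_eq gr0I not0_implies_Suc)
  then show ?case
  proof cases
    case 3
    let ?D = "var 1 ^ (i + 1) * var (i + 2) - var 1 * var 2 ^ (i + 1)"
    have "var 1 ^ (i * i + i) * curve_equation i - var 1 * ?D ^ i \<in> Q"
      by (intro curve_equation_congruence prime less.IH) (use 3 less.prems in auto)
    moreover have "var 1 ^ (i * i + i) * curve_equation i \<in> Q"
      using 3 less.prems by (intro mult_mem eqs) auto
    ultimately have "var 1 * ?D ^ i \<in> Q"
      using mem_cong by blast
    then have "?D \<in> Q"
      using x1 prime_mem power_memD by blast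
    then show ?thesis
      using 3 by simp
  qed (simp_all add: zero_mem numeral_2_eq_2)
qed

text \<open>In \<open>curve_equation j\<close> each term with a < j contains x_{a+1}, already known
  to be in \<open>Q\<close>. What remains is, up to sign, x_{j+1}^(j+1).\<close>

lemma var_mem_of_equations:
  assumes x1: "var 1 \<in> Q" and eqs: "\<And>i. 1 \<le> i \<Longrightarrow> i < n \<Longrightarrow> curve_equation i \<in> Q" and "j < n"
  shows "var (j + 1) \<in> Q"
  using \<open>j < n\<close>
proof (induction j rule: less_induct)
  case (less j)
  show ?case
  proof (cases "j = 0")
    case False
    let ?t = "\<lambda>a. (- 1) ^ a * of_nat (j choose a) * var (j + 2) ^ (j - a) * var (j + 1) ^ a * var (a + 1)
      :: (nat \<Rightarrow>\<^sub>0 nat) \<Rightarrow>\<^sub>0 'k"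
    have "curve_equation j = ?t j + (\<Sum>a\<in>{..j} - {j}. ?t a)"
      unfolding curve_equation_def by (rule sum.remove) auto
    moreover have "(\<Sum>a\<in>{..j} - {j}. ?t a) \<in> Q"
      using less by (intro sum_mem mult_mem less.IH) auto
    moreover have "curve_equation j \<in> Q"
      using False less.prems by (intro eqs) auto
    ultimately have "?t j \<in> Q"
      using diff_mem[of "curve_equation j" "\<Sum>a\<in>{..j} - {j}. ?t a"] by simp
    then have "(- 1) ^ j * var (j + 1) ^ Suc j \<in> Q"
      by (simp add: ac_simps)
    from mult_mem[OF this, of "(- 1) ^ j"] have "var (j + 1) ^ Suc j \<in> Q"
      by (simp flip: mult.assoc power_add)
    then show ?thesis
      by (rule power_memD)
  qed (use x1 in simp)
qed

lemma hankel_binomial_mem_of_equations: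
  assumes "\<And>i. 1 \<le> i \<Longrightarrow> i < n \<Longrightarrow> curve_equation i \<in> Q" "1 \<le> i" "i \<le> n" "1 \<le> j" "j \<le> n"
  shows "hankel_binomial i j \<in> Q"
proof (cases "var 1 \<in> Q")
  case True
  then have "var i \<in> Q" "var j \<in> Q"
    using var_mem_of_equations[of n "i - 1"] var_mem_of_equations[of n "j - 1"] assms by auto
  then show ?thesis
    unfolding hankel_binomial_def by (intro diff_mem mult_mem_right)
next
  case False
  then show ?thesis
    using curve_of_equations[OF False, of n] assms by (intro hankel_binomial_mem_of_curve[OF prime]) auto
qed

text \<open>On the plane x_2 = ... = x_n = 0 only the term a = 0, that is x_{i+2}^i x_1, can
  survive, and only for i = n - 1. There g_{1,n} reduces to x_1 x_{n+1} and removes it.\<close>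

lemma curve_equation_mem:
  assumes path: "\<And>i. 1 \<le> i \<Longrightarrow> i < n \<Longrightarrow> hankel_binomial i (i + 1) \<in> Q"
    and cycle: "hankel_binomial 1 n \<in> Q" and i: "1 \<le> i" "i < n"
  shows "curve_equation i \<in> Q"
  using path_primes[OF prime path, of n]
proof
  assume vars: "\<forall>i\<in>{2..n}. var i \<in> Q"
  have "hankel_binomial 1 n + var n * var 2 \<in> Q"
    using vars i by (intro add_mem cycle mult_mem) auto
  then have ends: "var (n + 1) * var 1 \<in> Q"
    by (simp add: hankel_binomial_def numeral_2_eq_2 mult.commute)
  show ?thesis
    unfolding curve_equation_def
  proof (rule sum_mem)
    fix a assume "a \<in> {..i}"
    show "(- 1) ^ a * of_nat (i choose a) * var (i + 2) ^ (i - a) * var (i + 1) ^ a * var (a + 1) \<in> Q"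
    proof (cases "a = 0")
      case True
      have "var (i + 2) ^ i * var 1 \<in> Q"
      proof (cases "i + 1 = n")
        case True
        have "var (i + 2) ^ i * var 1 = var (i + 2) ^ (i - 1) * (var (n + 1) * var 1 :: (nat \<Rightarrow>\<^sub>0 nat) \<Rightarrow>\<^sub>0 'k)"
          using i True by (cases i) (auto simp: mult.assoc mult.left_commute)
        then show ?thesis
          using mult_mem[OF ends] by simp
      next
        case False
        then show ?thesis
          using vars i by (intro mult_mem_right power_mem) auto
      qed
      then show ?thesis
        using True by simp
    next
      case False
      then show ?thesis
        using vars i by (intro mult_mem_right[OF mult_mem] power_mem) auto
    qed
  qed
next
  assume "var 1 \<notin> Q \<and> (\<forall>j\<le>n. curve_congruence Q j)"
  then have x1: "var 1 \<notin> Q" and curve: "\<And>j. j \<le> n \<Longrightarrow> curve_congruence Q j"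
    by auto
  let ?D = "var 1 ^ (i + 1) * var (i + 2) - var 1 * var 2 ^ (i + 1)"
  have "var 1 ^ (i * i + i) * curve_equation i - var 1 * ?D ^ i \<in> Q"
    using i by (intro curve_equation_congruence prime curve) auto
  moreover have "var 1 * ?D ^ i \<in> Q"
    using curve[of "i + 1"] i by (intro mult_mem power_mem) auto
  ultimately have "var 1 ^ (i * i + i) * curve_equation i \<in> Q"
    using mem_cong by blast
  then show ?thesis
    using x1 prime_mem power_memD by blast
qed

end

section \<open>Hankel edge ideals\<close>

lemma hankel_binomial_closed:
  assumes "1 \<le> i" "i \<le> n" "1 \<le> j" "j \<le> n"
  shows "hankel_binomial i j \<in> carrier (hankel_ring n)"
  unfolding hankel_binomial_def using assms by (intro poly_ring_closed) auto

lemma curve_equation_closed: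
  assumes "i < n"
  shows "curve_equation i \<in> carrier (hankel_ring n)"
proof -
  have "of_nat k \<in> carrier (hankel_ring n)" for k
    using poly_ring_const[of "of_nat k"] by (simp add: single_of_nat)
  then show ?thesis
    unfolding curve_equation_def using assms by (intro poly_ring_closed) auto
qed

lemma edge_bounds:
  assumes "simple_graph {1..n} E" "{i, j} \<in> E"
  shows "1 \<le> i" "i \<le> n" "1 \<le> j" "j \<le> n"
  using assms unfolding simple_graph_def by fastforce+

lemma hankel_edge_ideal:
  assumes "simple_graph {1..n} E"
  shows "ideal (hankel_edge_ideal n E) (hankel_ring n)"
    and "ideal I (hankel_ring n) \<Longrightarrow> hankel_edge_ideal n E \<subseteq> I \<longleftrightarrow>
      (\<forall>i j. i < j \<and> {i, j} \<in> E \<longrightarrow> hankel_binomial i j \<in> I)"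
proof -
  interpret cring "hankel_ring n" by (rule cring_poly_ring)
  let ?S = "{hankel_binomial i j | i j. i < j \<and> {i, j} \<in> E}"
  have S: "?S \<subseteq> carrier (hankel_ring n)"
    using hankel_binomial_closed edge_bounds[OF assms] by blast
  then show "ideal (hankel_edge_ideal n E) (hankel_ring n)"
    unfolding hankel_edge_ideal_def by (rule genideal_ideal)
  show "hankel_edge_ideal n E \<subseteq> I \<longleftrightarrow> (\<forall>i j. i < j \<and> {i, j} \<in> E \<longrightarrow> hankel_binomial i j \<in> I)"
    if "ideal I (hankel_ring n)"
    unfolding hankel_edge_ideal_def Idl_subset_iff[OF S that] by blast
qed

lemma lift_ideal_outside:
  assumes "primeideal Q (poly_ring V)" "i \<notin> V"
  shows "var i \<in> lift_ideal V Q"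
  using assms(2) ideal_poly_ringD(2)[OF primeideal.axioms(1)[OF assms(1)]]
  by (simp add: lift_ideal_def restrict_vars_def)

lemma prime_height_ge_of_path:
  fixes Q :: "((nat \<Rightarrow>\<^sub>0 nat) \<Rightarrow>\<^sub>0 'k::field) set"
  assumes Q: "primeideal Q (hankel_ring n)" and n: "n \<ge> 1"
    and path: "\<And>i. 1 \<le> i \<Longrightarrow> i < n \<Longrightarrow> hankel_binomial i (i + 1) \<in> Q"
  shows "enat (n - 1) \<le> prime_height (hankel_ring n) Q"
proof -
  let ?Q = "lift_ideal {1..n + 1} Q"
  have prime: "prime_subset ?Q"
    by (rule prime_subset_lift_ideal[OF Q])
  have "hankel_binomial i (i + 1) \<in> ?Q" if "1 \<le> i" "i < n" for i
  proof -
    have "hankel_binomial i (i + 1) \<in> (carrier (hankel_ring n) :: ((nat \<Rightarrow>\<^sub>0 nat) \<Rightarrow>\<^sub>0 'k) set)"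
      using that by (intro hankel_binomial_closed) auto
    then show ?thesis
      using mem_lift_ideal_iff path[OF that] by blast
  qed
  then consider "\<forall>i\<in>{2..n}. var i \<in> ?Q" | "var 1 \<notin> ?Q" "\<forall>j\<le>n. curve_congruence ?Q j"
    using path_primes[OF prime, of n] by blast
  then show ?thesis
  proof cases
    case 1
    have "var i \<in> Q" if "i \<in> {2..n}" for i
    proof -
      have "var i \<in> (carrier (hankel_ring n) :: ((nat \<Rightarrow>\<^sub>0 nat) \<Rightarrow>\<^sub>0 'k) set)"
        using that by (intro var_in_carrier) auto
      then show ?thesis
        using mem_lift_ideal_iff 1 that by blast
    qed
    then show ?thesis
      using prime_height_ge_of_coordinates[OF Q] by blast
  next
    case 2
    have "curve_ideal n \<subseteq> ?Q"
      using 2 by (intro curve_ideal_subset[OF prime n] lift_ideal_outside[OF Q]) auto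
    then have "curve_ideal n \<inter> carrier (hankel_ring n) \<subseteq> Q"
      using mem_lift_ideal_iff by blast
    then show ?thesis
      by (rule prime_height_ge_of_curve[OF Q n])
  qed
qed

lemma hankel_binomial_mem_curve_ideal:
  assumes "1 \<le> i" "i \<le> n" "1 \<le> j" "j \<le> n"
  shows "hankel_binomial i j \<in> curve_ideal n"
proof -
  obtain a b where "i = Suc a" "j = Suc b"
    using assms by (metis Suc_le_D One_nat_def)
  then show ?thesis
    using assms by (simp add: curve_ideal_def hankel_binomial_def subst_simps curve_subst_def algebra_simps)
qed

lemma path_edgeD:
  assumes "path_edges n \<subseteq> E" "1 \<le> i" "i < n"
  shows "{i, i + 1} \<in> E"
  using assms by (auto simp: path_edges_def)

text \<open>One prime suffices for the upper bound. The cone is chosen because all binomials vanish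
  on it; the plane would fail when {1,n} is an edge.\<close>

lemma ideal_height_hankel_edge_ideal:
  assumes n: "1 \<le> n" and E: "simple_graph {1..n} E" and path: "path_edges n \<subseteq> E"
  shows "ideal_height (hankel_ring n) (hankel_edge_ideal n E :: ((nat \<Rightarrow>\<^sub>0 nat) \<Rightarrow>\<^sub>0 'k::field) set) = enat (n - 1)"
proof (rule antisym)
  let ?I = "hankel_edge_ideal n E :: ((nat \<Rightarrow>\<^sub>0 nat) \<Rightarrow>\<^sub>0 'k::field) set"
  let ?P = "curve_ideal n \<inter> carrier (hankel_ring n) :: ((nat \<Rightarrow>\<^sub>0 nat) \<Rightarrow>\<^sub>0 'k::field) set"
  have P: "primeideal ?P (hankel_ring n)"
    by (rule primeideal_Int_carrier[OF prime_subset_curve_ideal])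
  moreover have "?I \<subseteq> ?P"
    unfolding hankel_edge_ideal(2)[OF E primeideal.axioms(1)[OF P]]
    using edge_bounds[OF E] hankel_binomial_mem_curve_ideal hankel_binomial_closed by blast
  ultimately have "ideal_height (hankel_ring n) ?I \<le> prime_height (hankel_ring n) ?P"
    unfolding ideal_height_def by (intro Inf_lower) blast
  also have "\<dots> \<le> enat (n - 1)"
    by (rule prime_height_curve_le[OF n])
  finally show "ideal_height (hankel_ring n) ?I \<le> enat (n - 1)" .
  show "enat (n - 1) \<le> ideal_height (hankel_ring n) ?I"
    unfolding ideal_height_def
  proof (rule Inf_greatest, clarify)
    fix Q assume Q: "primeideal Q (hankel_ring n)" "?I \<subseteq> Q"
    show "enat (n - 1) \<le> prime_height (hankel_ring n) Q"
    proof (rule prime_height_ge_of_path[OF Q(1) n])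
      show "hankel_binomial i (i + 1) \<in> Q" if "1 \<le> i" "i < n" for i
        using Q(2) path_edgeD[OF path that]
        unfolding hankel_edge_ideal(2)[OF E primeideal.axioms(1)[OF Q(1)]] by simp
    qed
  qed
qed

section \<open>Lower and upper bound for the arithmetical rank\<close>

lemma subst_zero_eq_const:
  fixes p :: "('v \<Rightarrow>\<^sub>0 nat) \<Rightarrow>\<^sub>0 'k::comm_ring_1"
  shows "subst (\<lambda>_. 0 :: ('w \<Rightarrow>\<^sub>0 nat) \<Rightarrow>\<^sub>0 'k) p = Poly_Mapping.single 0 (Poly_Mapping.lookup p 0)"
proof (induction p rule: poly_mapping_single_induct)
  case (single m c)
  show ?case
  proof (cases "m = 0")
    case False
    then obtain v where "v \<in> Poly_Mapping.keys m"
      by fastforce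
    then have "subst_monom (\<lambda>_. 0) m = (0 :: ('w \<Rightarrow>\<^sub>0 nat) \<Rightarrow>\<^sub>0 'k)"
      unfolding subst_monom_def by (intro prod_zero) (auto simp: in_keys_iff power_0_left intro!: bexI[of _ v])
    then show ?thesis
      using False by (simp add: subst_single lookup_single_not_eq)
  qed simp
qed (simp add: subst_add lookup_add single_add)

text \<open>Cutting with the two hyperplanes \<open>x\<^sub>1 = 0\<close> and \<open>x\<^bsub>n+1\<^esub> = 0\<close> leaves only the origin of the
  \<open>n+1\<close>-dimensional space.\<close>

lemma ara_lower_bound:
  fixes f :: "nat \<Rightarrow> (nat \<Rightarrow>\<^sub>0 nat) \<Rightarrow>\<^sub>0 'k::field"
  assumes E: "simple_graph {1..n} E" and path: "path_edges n \<subseteq> E"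
    and f: "f ` {1..r} \<subseteq> carrier (hankel_ring n)"
    and rad: "radical (hankel_ring n) (hankel_edge_ideal n E) =
      radical (hankel_ring n) (Idl\<^bsub>hankel_ring n\<^esub> (f ` {1..r}))"
  shows "n - 1 \<le> r"
proof -
  let ?R = "hankel_ring n :: ((nat \<Rightarrow>\<^sub>0 nat) \<Rightarrow>\<^sub>0 'k) ring"
  let ?C = "carrier ?R" and ?V = "{1..n + 1}"
  let ?I = "hankel_edge_ideal n E :: ((nat \<Rightarrow>\<^sub>0 nat) \<Rightarrow>\<^sub>0 'k) set"
  interpret cring ?R by (rule cring_poly_ring)
  have sub_rad: "A \<subseteq> radical ?R A" if "A \<subseteq> ?C" for A
    using that unfolding radical_def by (auto simp: poly_ring_nat_pow intro!: exI[of _ 1])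
  have IC: "?I \<subseteq> ?C"
    by (rule ideal_poly_ringD(1)[OF hankel_edge_ideal(1)[OF E]])
  have JC: "Idl\<^bsub>?R\<^esub> (f ` {1..r}) \<subseteq> ?C"
    by (rule ideal_poly_ringD(1)[OF genideal_ideal[OF f]])
  have f_rad: "f i \<in> radical ?R ?I" if "i \<in> {1..r}" for i
    unfolding rad using sub_rad[OF JC] genideal_self[OF f] that by blast
  define g where "g i = (if i \<le> r then f i else if i = r + 1 then var 1 else var (n + 1))" for i
  have gC: "g i \<in> ?C" if "i \<in> {1..r + 2}" for i
  proof (cases "i \<le> r")
    case True
    then show ?thesis
      using that f by (auto simp: g_def)
  next
    case False
    then show ?thesis
      by (auto simp: g_def intro: var_in_carrier)
  qed
  \<comment> \<open>The edge ideal vanishes at the origin, hence so does its radical. This is how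
    the \<open>f i\<close> are seen to have no constant term.\<close>
  have origin: "primeideal (origin_ideal \<inter> ?C) ?R"
    by (rule primeideal_Int_carrier[OF prime_subset_origin_ideal])
  have "?I \<subseteq> origin_ideal \<inter> ?C"
    unfolding hankel_edge_ideal(2)[OF E primeideal.axioms(1)[OF origin]]
  proof (intro allI impI IntI)
    show "hankel_binomial i j \<in> origin_ideal" for i j
      by (simp add: origin_ideal_def hankel_binomial_def subst_simps)
    show "hankel_binomial i j \<in> ?C" if "i < j \<and> {i, j} \<in> E" for i j
      using that by (intro hankel_binomial_closed edge_bounds[OF E, of i j]) auto
  qed
  then have "radical ?R ?I \<subseteq> origin_ideal \<inter> ?C"
    by (rule primeideal.radical_subset[OF origin])
  then have "f i \<in> origin_ideal" if "i \<in> {1..r}" for i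
    using f_rad[OF that] by blast
  moreover have "var i \<in> (origin_ideal :: ((nat \<Rightarrow>\<^sub>0 nat) \<Rightarrow>\<^sub>0 'k) set)" for i
    by (simp add: origin_ideal_def)
  ultimately have "g i \<in> origin_ideal" if "i \<in> {1..r + 2}" for i
    using that by (simp add: g_def)
  then have g0: "Poly_Mapping.lookup (g i) 0 = 0" if "i \<in> {1..r + 2}" for i
    using that unfolding origin_ideal_def subst_zero_eq_const mem_Collect_eq
    by (metis lookup_single_eq lookup_zero)
  have pow: "\<exists>N. var v ^ N \<in> Idl\<^bsub>?R\<^esub> (g ` {1..r + 2})" if v: "v \<in> ?V" for v
  proof -
    have J: "ideal (Idl\<^bsub>?R\<^esub> (g ` {1..r + 2})) ?R"
      using gC by (intro genideal_ideal) auto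
    have "var v \<in> radical ?R (Idl\<^bsub>?R\<^esub> (g ` {1..r + 2}))"
    proof (rule mem_radical_if_mem_primes[OF J var_in_carrier[OF v]])
      fix Q assume Q: "primeideal Q ?R" "Idl\<^bsub>?R\<^esub> (g ` {1..r + 2}) \<subseteq> Q"
      let ?Q = "lift_ideal ?V Q"
      have Q': "ideal Q ?R"
        by (rule primeideal.axioms(1)[OF Q(1)])
      have prime: "prime_subset ?Q"
        by (rule prime_subset_lift_ideal[OF Q(1)])
      have gQ: "g i \<in> Q" if "i \<in> {1..r + 2}" for i
        using Q(2) that gC by (subst (asm) Idl_subset_iff[OF _ Q']) auto
      have ends: "var 1 \<in> Q" "var (n + 1) \<in> Q"
        using gQ[of "r + 1"] gQ[of "r + 2"] by (simp_all add: g_def)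
      have "f i \<in> Q" if "i \<in> {1..r}" for i
        using gQ[of i] that by (simp add: g_def)
      then have "Idl\<^bsub>?R\<^esub> (f ` {1..r}) \<subseteq> Q"
        by (subst Idl_subset_iff[OF f Q']) auto
      then have "?I \<subseteq> Q"
        using primeideal.radical_subset[OF Q(1)] sub_rad[OF IC] rad by blast
      then have edges: "hankel_binomial i j \<in> Q" if "i < j" "{i, j} \<in> E" for i j
        using that hankel_edge_ideal(2)[OF E Q'] by blast
      have "hankel_binomial i (i + 1) \<in> ?Q" if "1 \<le> i" "i < n" for i
      proof -
        have "hankel_binomial i (i + 1) \<in> ?C"
          using that by (intro hankel_binomial_closed) auto
        moreover have "hankel_binomial i (i + 1) \<in> Q"
          using path_edgeD[OF path that] by (intro edges) auto
        ultimately show ?thesis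
          using mem_lift_ideal_iff by blast
      qed
      moreover have "var 1 \<in> ?Q"
        using ends(1) var_in_carrier[of 1 ?V] mem_lift_ideal_iff by fastforce
      \<comment> \<open>Starting from x_1, membership propagates along the path up to x_n; the
        remaining variable x_{n+1} is itself one of the generators.\<close>
      ultimately have "var v \<in> ?Q" if "v \<le> n"
        using path_var_mem[OF prime, of n 1 v] v that by simp
      then show "var v \<in> Q"
        using ends(2) v mem_lift_ideal_iff[OF var_in_carrier[OF v]] by (cases "v \<le> n") (auto simp: le_Suc_eq)
    qed
    then show ?thesis
      by (auto simp: radical_def poly_ring_nat_pow)
  qed
  have "card ?V \<le> r + 2"
    by (rule card_le_number_of_generators[OF _ gC g0 pow]) auto
  then show ?thesis
    by simp
qed

lemma ara_upper_bound:
  assumes E: "simple_graph {1..n} E"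
    and G: "labeled_hamiltonian n E \<or> labeled_semi_hamiltonian n E"
  shows "\<exists>f :: nat \<Rightarrow> (nat \<Rightarrow>\<^sub>0 nat) \<Rightarrow>\<^sub>0 'k::field. f ` {1..n - 1} \<subseteq> carrier (hankel_ring n) \<and>
    radical (hankel_ring n) (hankel_edge_ideal n E) =
      radical (hankel_ring n) (Idl\<^bsub>hankel_ring n\<^esub> (f ` {1..n - 1}))"
proof -
  let ?R = "hankel_ring n :: ((nat \<Rightarrow>\<^sub>0 nat) \<Rightarrow>\<^sub>0 'k) ring"
  interpret cring ?R by (rule cring_poly_ring)
  \<comment> \<open>Comparison of radicals on primes, with each prime replaced by its lift: both
    kinds of graphs now reduce to a statement about an arbitrary
    \<open>prime_subset\<close>.\<close>
  have criterion: ?thesis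
    if f: "\<And>i. 1 \<le> i \<Longrightarrow> i < n \<Longrightarrow> f i \<in> carrier ?R"
      and primes: "\<And>Q. prime_subset Q \<Longrightarrow> (\<forall>i. 1 \<le> i \<longrightarrow> i < n \<longrightarrow> f i \<in> Q) \<longleftrightarrow>
        (\<forall>i j. i < j \<and> {i, j} \<in> E \<longrightarrow> hankel_binomial i j \<in> Q)" for f
  proof (intro exI[of _ f] conjI radical_eqI)
    show fC: "f ` {1..n - 1} \<subseteq> carrier ?R"
      using f by auto
    show "ideal (hankel_edge_ideal n E) ?R"
      by (rule hankel_edge_ideal[OF E])
    show "ideal (Idl\<^bsub>?R\<^esub> (f ` {1..n - 1})) ?R"
      by (rule genideal_ideal[OF fC])
    fix Q assume Q: "primeideal Q ?R"
    let ?Q = "lift_ideal {1..n + 1} Q"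
    have Q': "ideal Q ?R"
      by (rule primeideal.axioms(1)[OF Q])
    have "hankel_edge_ideal n E \<subseteq> Q \<longleftrightarrow> (\<forall>i j. i < j \<and> {i, j} \<in> E \<longrightarrow> hankel_binomial i j \<in> ?Q)"
    proof -
      have "hankel_binomial i j \<in> ?Q \<longleftrightarrow> hankel_binomial i j \<in> Q" if "{i, j} \<in> E" for i j
        by (intro mem_lift_ideal_iff hankel_binomial_closed edge_bounds[OF E that])
      then show ?thesis
        unfolding hankel_edge_ideal(2)[OF E Q'] by blast
    qed
    also have "\<dots> \<longleftrightarrow> (\<forall>i. 1 \<le> i \<longrightarrow> i < n \<longrightarrow> f i \<in> ?Q)"
      by (rule primes[OF prime_subset_lift_ideal[OF Q], symmetric])
    also have "\<dots> \<longleftrightarrow> (\<forall>i. 1 \<le> i \<longrightarrow> i < n \<longrightarrow> f i \<in> Q)"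
      using mem_lift_ideal_iff[OF f] by blast
    also have "\<dots> \<longleftrightarrow> f ` {1..n - 1} \<subseteq> Q"
      by (auto simp: image_subset_iff)
    also have "\<dots> \<longleftrightarrow> Idl\<^bsub>?R\<^esub> (f ` {1..n - 1}) \<subseteq> Q"
      by (rule Idl_subset_iff[OF fC Q', symmetric])
    finally show "hankel_edge_ideal n E \<subseteq> Q \<longleftrightarrow> Idl\<^bsub>?R\<^esub> (f ` {1..n - 1}) \<subseteq> Q" .
  qed
  from G show ?thesis
  proof
    assume ham: "labeled_hamiltonian n E"
    then have path: "path_edges n \<subseteq> E" and cycle: "{1, n} \<in> E" "1 < n"
      by (auto simp: labeled_hamiltonian_def cycle_edges_def)
    show ?thesis
    proof (rule criterion[of curve_equation])
      fix Q :: "((nat \<Rightarrow>\<^sub>0 nat) \<Rightarrow>\<^sub>0 'k) set"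
      assume Q: "prime_subset Q"
      show "(\<forall>i. 1 \<le> i \<longrightarrow> i < n \<longrightarrow> curve_equation i \<in> Q) \<longleftrightarrow>
          (\<forall>i j. i < j \<and> {i, j} \<in> E \<longrightarrow> hankel_binomial i j \<in> Q)"
      proof (intro iffI allI impI)
        fix i j assume "\<forall>i. 1 \<le> i \<longrightarrow> i < n \<longrightarrow> curve_equation i \<in> Q" and ij: "i < j \<and> {i, j} \<in> E"
        then show "hankel_binomial i j \<in> Q"
          using edge_bounds[OF E, of i j] by (intro hankel_binomial_mem_of_equations[OF Q, of n]) auto
      next
        fix i assume edges: "\<forall>i j. i < j \<and> {i, j} \<in> E \<longrightarrow> hankel_binomial i j \<in> Q" and i: "1 \<le> i" "i < n"
        then show "curve_equation i \<in> Q"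
          using path_edgeD[OF path] cycle by (intro curve_equation_mem[OF Q _ _ i]) simp_all
      qed
    qed (rule curve_equation_closed)
  next
    assume semi: "labeled_semi_hamiltonian n E"
    then have path: "path_edges n \<subseteq> E" and no_cycle: "{1, n} \<notin> E"
      by (auto simp: labeled_semi_hamiltonian_def)
    show ?thesis
    proof (rule criterion[of "\<lambda>i. hankel_binomial i (i + 1)"])
      fix Q :: "((nat \<Rightarrow>\<^sub>0 nat) \<Rightarrow>\<^sub>0 'k) set"
      assume Q: "prime_subset Q"
      interpret Q: prime_subset Q by fact
      show "(\<forall>i. 1 \<le> i \<longrightarrow> i < n \<longrightarrow> hankel_binomial i (i + 1) \<in> Q) \<longleftrightarrow>
          (\<forall>i j. i < j \<and> {i, j} \<in> E \<longrightarrow> hankel_binomial i j \<in> Q)"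
      proof (intro iffI allI impI)
        fix i j assume paths: "\<forall>i. 1 \<le> i \<longrightarrow> i < n \<longrightarrow> hankel_binomial i (i + 1) \<in> Q"
          and ij: "i < j \<and> {i, j} \<in> E"
        then have bounds: "1 \<le> i" "i \<le> n" "1 \<le> j" "j \<le> n"
          using edge_bounds[OF E] by auto
        consider "\<forall>i\<in>{2..n}. var i \<in> Q" | "var 1 \<notin> Q" "\<forall>j\<le>n. curve_congruence Q j"
          using path_primes[OF Q, of n] paths by blast
        then show "hankel_binomial i j \<in> Q"
        proof cases
          case 1
          \<comment> \<open>Both x_i and x_{j+1} escape the list x_2, ..., x_n only if i = 1 and j =
            n, which is the excluded edge. The other product contains x_j, and j is at least
            2.\<close>
          have "var i \<in> Q \<or> var (j + 1) \<in> Q"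
          proof (cases "i = 1")
            case True
            then have "j \<noteq> n"
              using ij no_cycle by auto
            then show ?thesis
              using 1 bounds by auto
          qed (use 1 bounds in auto)
          moreover have "var j \<in> Q"
            using 1 bounds ij by auto
          ultimately show ?thesis
            unfolding hankel_binomial_def by (meson Q.diff_mem Q.mult_mem Q.mult_mem_right)
        next
          case 2
          then show ?thesis
            using bounds by (intro hankel_binomial_mem_of_curve[OF Q, of n]) auto
        qed
      next
        fix i assume "\<forall>i j. i < j \<and> {i, j} \<in> E \<longrightarrow> hankel_binomial i j \<in> Q" "1 \<le> i" "i < n"
        then show "hankel_binomial i (i + 1) \<in> Q"
          using path_edgeD[OF path] by simp
      qed
    qed (rule hankel_binomial_closed, auto)
  qed
qed

theorem proposition2p8:
  fixes n :: nat and E :: "nat set set"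
  assumes "1 \<le> n"
    and "simple_graph {1..n} E"
    and "connected_graph {1..n} E"
    and "labeled_hamiltonian n E \<or> labeled_semi_hamiltonian n E"
  shows "ara (hankel_ring n) (hankel_edge_ideal n E :: ((nat \<Rightarrow>\<^sub>0 nat) \<Rightarrow>\<^sub>0 'k::field) set) = n - 1
    \<and> set_theoretic_complete_intersection (hankel_ring n)
        (hankel_edge_ideal n E :: ((nat \<Rightarrow>\<^sub>0 nat) \<Rightarrow>\<^sub>0 'k) set)"
proof -
  have path: "path_edges n \<subseteq> E"
    using assms(4) by (auto simp: labeled_hamiltonian_def labeled_semi_hamiltonian_def cycle_edges_def)
  have ara: "ara (hankel_ring n) (hankel_edge_ideal n E :: ((nat \<Rightarrow>\<^sub>0 nat) \<Rightarrow>\<^sub>0 'k) set) = n - 1"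
    unfolding ara_def
  proof (rule Least_equality)
    fix r assume "\<exists>f :: nat \<Rightarrow> (nat \<Rightarrow>\<^sub>0 nat) \<Rightarrow>\<^sub>0 'k. f ` {1..r} \<subseteq> carrier (hankel_ring n) \<and>
      radical (hankel_ring n) (hankel_edge_ideal n E) =
        radical (hankel_ring n) (Idl\<^bsub>hankel_ring n\<^esub> (f ` {1..r}))"
    then show "n - 1 \<le> r"
      using ara_lower_bound[OF assms(2) path] by blast
  qed (rule ara_upper_bound[OF assms(2,4)])
  then show ?thesis
    unfolding set_theoretic_complete_intersection_def
      ideal_height_hankel_edge_ideal[OF assms(1,2) path] by simp
qed

end
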